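(* Let $K$ be a field and let $\mathbb{X}$ be a finite subset of the projective space $\mathbb{P}^{s-1}$ over $K$ with $|\mathbb{X}|\geq 2$. Let $I(\mathbb{X})\subset S=K[t_1,\ldots,t_s]$ be its vanishing ideal, and let $\delta_\mathbb{X}(d,r)$ be the $r$-th generalized Hamming weight of the code $C_\mathbb{X}(d)$. Then $$\delta_\mathbb{X}(d,r)=\delta_{I(\mathbb{X})}(d,r)=\vartheta_{I(\mathbb{X})}(d,r)\quad\mbox{for all } d\geq 1 \mbox{ and } 1\leq r\leq H_{I(\mathbb{X})}(d),$$ and $\delta_\mathbb{X}(d,r)=r$ for all $d\geq \mathrm{reg}(S/I(\mathbb{X}))$ (and $1\le r\le H_{I(\mathbb{X})}(d)$).
   Context: $S=K[t_1,\ldots,t_s]=\bigoplus_{d\ge 0}S_d$ is a polynomial ring over the field $K$ with the standard grading. For a graded ideal $I\subset S$, $I_d=I\cap S_d$, the Hilbert function is $H_I(d)=\dim_K(S_d/I_d)$, $h_I$ is the Hilbert polynomial (so $H_I(d)=h_I(d)$ for $d\gg 0$), and $\mathrm{reg}(S/I)$ is the least integer $r_0\geq 0$ such that $H_I(d)=h_I(d)$ for all $d\geq r_0$. If $k=\dim(S/I)$ is the Krull dimension, the degree is $\deg(S/I)=(k-1)!\lim_{d\to\infty}H_I(d)/d^{k-1}$ if $k\geq 1$, and $\deg(S/I)=\dim_K(S/I)$ if $k=0$ (the zero ring has degree $0$). For $F\subset S$, $(I\colon(F))=\{g\in S : gf\in I \ \forall f\in F\}$, and $(I,F)$ is the ideal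 generated by $I$ and $F$. For integers $d,r\geq 1$, $\mathcal{F}_{d,r}$ is the set of all $F=\{f_1,\ldots,f_r\}\subset S_d$ such that the classes $\overline{f}_1,\ldots,\overline{f}_r$ in $S/I$ are linearly independent over $K$ and $(I\colon(F))\neq I$. The generalized minimum distance function of $I$ is $\delta_I(d,r)=\deg(S/I)-\max\{\deg(S/(I,F)) : F\in\mathcal{F}_{d,r}\}$ if $\mathcal{F}_{d,r}\neq\emptyset$, and $\delta_I(d,r)=\deg(S/I)$ otherwise. The Vasconcelos function of $I$ is $\vartheta_I(d,r)=\min\{\deg(S/(I\colon(F))) : F\in\mathcal{F}_{d,r}\}$ if $\mathcal{F}_{d,r}\neq\emptyset$, and $\vartheta_I(d,r)=\deg(S/I)$ otherwise. $I(\mathbb{X})$ is the ideal generated by the homogeneous polynomials vanishing at all points of $\mathbb{X}$. Write $\mathbb{X}=\{[P_1],\ldots,[P_m]\}$ with $m=|\mathbb{X}|$ and representatives $P_i\in K^s$ whose first non-zero entry is $1$. $C_\mathbb{X}(d)$ is the image of the $K$-linear map $S_d\to K^m$, $f\mapsto(f(P_1),\ldots,f(P_m))$. For a linear subspace $D\subset K^m$, $\chi(D)=\{i : \exists (a_1,\ldots,a_m)\in D,\ a_i\neq 0\}$. For a linear subspace $C\subset K^m$ and $1\le r\le\dim_K C$, the $r$-th generalized Hamming weight is $\delta_r(C)=\min\{|\chi(D)| : D \mbox{ a linear subspace of } C,\ \dim_K D=r\}$, and $\delta_\mathbb{X}(d,r)=\delta_r(C_\mathbb{X}(d))$. *)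

theory Defs
  imports
    "HOL-Analysis.Analysis"
    "HOL-Algebra.Algebraic_Closure_Type"
    "HOL-Library.Poly_Mapping"
    "HOL-Library.Function_Algebras"
begin

section \<open>The polynomial ring\<close>

text \<open>
  \<open>('n, 'a) mpoly\<close> is \<open>S = K[t\<^sub>i | i \<in> 'n]\<close> with \<open>s = CARD('n)\<close>: finitely supported maps from
  exponent vectors to coefficients, with the convolution product. As a record for
  \<open>HOL-Algebra\<close> (ideals, quotient rings) it is written \<open>\<S>\<close>.
\<close>

type_synonym ('n, 'a) mpoly = "('n \<Rightarrow>\<^sub>0 nat) \<Rightarrow>\<^sub>0 'a"

abbreviation polyring :: "('n::finite, 'a::field) mpoly ring" (\<open>\<S>\<close>)
  where "\<S> \<equiv> ring_of_type_algebra"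

definition mdeg :: "('n::finite \<Rightarrow>\<^sub>0 nat) \<Rightarrow> nat"
  where "mdeg e = (\<Sum>i\<in>UNIV. Poly_Mapping.lookup e i)"

definition hom_part :: "nat \<Rightarrow> ('n::finite, 'a::field) mpoly set"
  where "hom_part d = {f. \<forall>e\<in>Poly_Mapping.keys f. mdeg e = d}"

definition eval_mpoly :: "('n::finite, 'a::field) mpoly \<Rightarrow> 'a ^ 'n \<Rightarrow> 'a"
  where "eval_mpoly f v = (\<Sum>e\<in>Poly_Mapping.keys f. Poly_Mapping.lookup f e * (\<Prod>i\<in>UNIV. (v $ i) ^ Poly_Mapping.lookup e i))"

definition mscale :: "'a \<Rightarrow> ('n::finite, 'a::field) mpoly \<Rightarrow> ('n, 'a) mpoly"
  where "mscale c f = Poly_Mapping.single 0 c * f"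

interpretation mp: vector_space "mscale :: 'a::field \<Rightarrow> ('n::finite, 'a) mpoly \<Rightarrow> ('n, 'a) mpoly"
proof
  show "mscale 1 f = f" for f :: "('n, 'a) mpoly"
    unfolding mscale_def by (metis mult_1_left single_one)
qed (simp_all add: mscale_def distrib_left distrib_right single_add mult_single flip: mult.assoc)


section \<open>Linear algebra modulo a subspace\<close>

text \<open>
  Elements of a quotient space \<open>V/W\<close> are handled through representatives: the classes of the
  elements of \<open>B\<close> are linearly independent if no non-trivial combination of elements of \<open>B\<close> lies
  in \<open>W\<close> (in particular, distinct elements of \<open>B\<close> have distinct classes).
\<close>

definition indep_mod :: "('n::finite, 'a::field) mpoly set \<Rightarrow> ('n, 'a) mpoly set \<Rightarrow> bool"
  where "indep_mod W B \<longleftrightarrow>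
    (\<forall>T c. finite T \<and> T \<subseteq> B \<and> (\<Sum>b\<in>T. mscale (c b) b) \<in> W \<longrightarrow> (\<forall>b\<in>T. c b = 0))"

definition basis_mod ::
    "('n::finite, 'a::field) mpoly set \<Rightarrow> ('n, 'a) mpoly set \<Rightarrow> ('n, 'a) mpoly set \<Rightarrow> bool"
  where "basis_mod V W B \<longleftrightarrow>
    B \<subseteq> V \<and> indep_mod W B \<and> (\<forall>v\<in>V. \<exists>u\<in>mp.span B. v - u \<in> W)"

text \<open>
  \<open>dim\<^sub>K (V/W)\<close> for subspaces \<open>W \<subseteq> V\<close>. All bases of \<open>V/W\<close> have the same cardinality; as for
  the library's \<open>dim\<close>, the value is 0 if \<open>V/W\<close> is infinite-dimensional.
\<close>

definition quot_dim :: "('n::finite, 'a::field) mpoly set \<Rightarrow> ('n, 'a) mpoly set \<Rightarrow> nat"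
  where "quot_dim V W = card (SOME B. basis_mod V W B)"


section \<open>Hilbert function, regularity, Krull dimension and degree\<close>

definition hilbert_fun :: "('n::finite, 'a::field) mpoly set \<Rightarrow> nat \<Rightarrow> nat"
  where "hilbert_fun I d = quot_dim (hom_part d) (I \<inter> hom_part d)"

definition hilbert_poly :: "('n::finite, 'a::field) mpoly set \<Rightarrow> rat poly"
  where "hilbert_poly I =
    (THE h. \<forall>\<^sub>F d in sequentially. of_nat (hilbert_fun I d) = poly h (of_nat d))"

definition reg :: "('n::finite, 'a::field) mpoly set \<Rightarrow> nat"
  where "reg I =
    (LEAST r\<^sub>0. \<forall>d\<ge>r\<^sub>0. of_nat (hilbert_fun I d) = poly (hilbert_poly I) (of_nat d))"

text \<open>
  Supremum of the lengths of strict chains of prime ideals; the zero ring, having no prime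
  ideals, gets dimension 0 here.
\<close>

definition krull_dim :: "('b, 'c) ring_scheme \<Rightarrow> enat"
  where "krull_dim R =
    (SUP n\<in>{n. \<exists>Q. (\<forall>i\<le>n. primeideal (Q i) R) \<and> (\<forall>i<n. Q i \<subset> Q (Suc i))}. enat n)"

text \<open>\<open>deg(S/I)\<close>; for \<open>I = S\<close> the case \<open>k = 0\<close> applies and gives 0.\<close>

definition quot_degree :: "('n::finite, 'a::field) mpoly set \<Rightarrow> real"
  where "quot_degree I =
    (let k = the_enat (krull_dim (\<S> Quot I)) in
      if k \<ge> 1
      then fact (k - 1) * lim (\<lambda>d. real (hilbert_fun I d) / real d ^ (k - 1))
      else real (quot_dim UNIV I))"


section \<open>Generalized minimum distance and Vasconcelos functions\<close>

definition colon :: "('n::finite, 'a::field) mpoly set \<Rightarrow> ('n, 'a) mpoly set \<Rightarrow> ('n, 'a) mpoly set"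
  where "colon I F = {g. \<forall>f\<in>F. g * f \<in> I}"

definition admissible ::
    "('n::finite, 'a::field) mpoly set \<Rightarrow> nat \<Rightarrow> nat \<Rightarrow> ('n, 'a) mpoly set set"  (\<open>\<F>\<close>)
  where "\<F> I d r = {F. F \<subseteq> hom_part d \<and> finite F \<and> card F = r \<and> indep_mod I F \<and> colon I F \<noteq> I}"

text \<open>
  For graded \<open>I\<close>, the ideals \<open>(I, F)\<close> and \<open>(I : (F))\<close> for \<open>F \<in> \<F> I d r\<close> have only finitely many
  Hilbert functions, hence degrees, so \<open>Max\<close> and \<open>Min\<close> below range over finite sets.
\<close>

definition gmd :: "('n::finite, 'a::field) mpoly set \<Rightarrow> nat \<Rightarrow> nat \<Rightarrow> real"
  where "gmd I d r =
    (if \<F> I d r \<noteq> {}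
     then quot_degree I - Max ((\<lambda>F. quot_degree (genideal \<S> (I \<union> F))) ` \<F> I d r)
     else quot_degree I)"

definition vasconcelos :: "('n::finite, 'a::field) mpoly set \<Rightarrow> nat \<Rightarrow> nat \<Rightarrow> real"
  where "vasconcelos I d r =
    (if \<F> I d r \<noteq> {}
     then Min ((\<lambda>F. quot_degree (colon I F)) ` \<F> I d r)
     else quot_degree I)"


section \<open>Projective points and vanishing ideals\<close>

definition proj_pt :: "'a::field ^ 'n::finite \<Rightarrow> ('a ^ 'n) set"
  where "proj_pt v = {c *s v | c. c \<noteq> 0}"

definition proj_space :: "('a::field ^ 'n::finite) set set"
  where "proj_space = {proj_pt v | v. v \<noteq> 0}"

text \<open>The first non-zero entry of \<open>v\<close> is 1.\<close>

definition normalized_rep :: "'a::field ^ 'n::{finite,linorder} \<Rightarrow> bool"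
  where "normalized_rep v \<longleftrightarrow> (\<exists>i. v $ i = 1 \<and> (\<forall>j<i. v $ j = 0))"

definition vanishing_ideal :: "('a::field ^ 'n::finite) set set \<Rightarrow> ('n, 'a) mpoly set"
  where "vanishing_ideal \<X> =
    genideal \<S> {f. (\<exists>d. f \<in> hom_part d) \<and> (\<forall>p\<in>\<X>. \<forall>v\<in>p. eval_mpoly f v = 0)}"


section \<open>Codes\<close>

text \<open>
  \<open>K\<^sup>m\<close> is the space of functions \<open>nat \<Rightarrow> K\<close> vanishing outside \<open>{1..m}\<close>, with pointwise operations.
\<close>

definition vscale :: "'a::field \<Rightarrow> (nat \<Rightarrow> 'a) \<Rightarrow> nat \<Rightarrow> 'a"
  where "vscale c a = (\<lambda>i. c * a i)"

interpretation vc: vector_space "vscale :: 'a::field \<Rightarrow> (nat \<Rightarrow> 'a) \<Rightarrow> nat \<Rightarrow> 'a"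
  by unfold_locales (auto simp: vscale_def fun_eq_iff algebra_simps)

definition eval_code :: "nat \<Rightarrow> (nat \<Rightarrow> 'a::field ^ 'n::finite) \<Rightarrow> nat \<Rightarrow> (nat \<Rightarrow> 'a) set"
  where "eval_code m P d =
    (\<lambda>f i. if i \<in> {1..m} then eval_mpoly f (P i) else 0) ` hom_part d"

definition code_supp :: "(nat \<Rightarrow> 'a::field) set \<Rightarrow> nat set"
  where "code_supp D = {i. \<exists>a\<in>D. a i \<noteq> 0}"

definition gen_hamming_weight :: "(nat \<Rightarrow> 'a::field) set \<Rightarrow> nat \<Rightarrow> nat"
  where "gen_hamming_weight C r = Min {card (code_supp D) | D. vc.subspace D \<and> D \<subseteq> C \<and> vc.dim D = r}"

end

theory Submission
  imports Defs
begin

text \<open>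
  Restricting a polynomial \<open>f\<close> to the line through a point \<open>P\<close> of the affine cone, \<open>f \<mapsto> f(t P)\<close>, is a
  ring homomorphism from \<open>S\<close> onto \<open>K[t]\<close>, and it sends a form of degree \<open>d\<close> to \<open>f(P) t\<^sup>d\<close>. Hence
  \<open>I(\<X>)\<close> is the intersection of the kernels belonging to the points \<open>P\<^sub>1, \<dots>, P\<^sub>m\<close> of \<open>\<X>\<close>
  (\<open>vanishing_ideal_eq\<close>). Let \<open>F\<close> be a set of \<open>r\<close> forms of degree \<open>d\<close>, linearly independent modulo
  \<open>I(\<X>)\<close>, and let \<open>A\<close> be the set of points at which some member of \<open>F\<close> does not vanish.

  The evaluation vectors of \<open>F\<close> span an \<open>r\<close>-dimensional subcode with support \<open>A\<close>, and every
  \<open>r\<close>-dimensional subcode arises in this way (\<open>subcode_weights\<close>). So the \<open>r\<close>-th generalized Hamming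
  weight is the least \<open>|A|\<close>. The other two invariants are computed from the same numbers:

  \<^item> Since \<open>K[t]\<close> is a domain, \<open>(I : (F))\<close> is the intersection of the kernels belonging to \<open>A\<close>
    (\<open>colon_eq\<close>), that is, the vanishing ideal of \<open>A\<close>. Its degree is \<open>|A|\<close>, and it differs from \<open>I(\<X>)\<close>
    exactly when \<open>A\<close> is not the set of all points.

  \<^item> In large degrees \<open>(I, F)\<close> consists of all forms that vanish outside \<open>A\<close>: products of the members
    of \<open>F\<close> with forms that are 1 at one point and 0 at the others (\<open>indicator_form\<close>) realize every value
    vector supported in \<open>A\<close>. So its degree is \<open>m - |A|\<close> (\<open>quot_degree_extended_ideal\<close>).

  These degrees are numbers of points because both quotients have Krull dimension 1. A prime that
  contains the finite intersection of kernels contains one of the kernels, and the primes above a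
  kernel are those of \<open>K[t]\<close>. The degree is therefore the eventual value of the Hilbert function,
  and evaluation at the points is surjective in large degrees (\<open>quot_degree_eq_card\<close>).

  Minimizing \<open>|A|\<close> over the sets \<open>F\<close> with \<open>A\<close> proper gives the equality of the three invariants; if \<open>A\<close>
  is always everything, all three equal \<open>m\<close>. Finally, the Hilbert polynomial is the constant \<open>m\<close>, so
  from the regularity on the code is all of \<open>K\<^sup>m\<close>, where coordinate subspaces have support no larger
  than their dimension.
\<close>

(* The symbol $ is to denote vector components only, not power series coefficients. *)
unbundle no fps_syntax

section \<open>Restricting polynomials to lines through the origin\<close>

text \<open>
  \<open>f(t v)\<close> as a polynomial in \<open>t\<close>. Its coefficients are the values at \<open>v\<close> of the homogeneous
  components of \<open>f\<close>, so that it detects the vanishing of all of them at once.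
\<close>


definition line_eval :: "'a::field ^ 'n::finite \<Rightarrow> ('n, 'a) mpoly \<Rightarrow> 'a poly"
  where "line_eval v f = (\<Sum>e\<in>Poly_Mapping.keys f.
    Polynomial.monom (Poly_Mapping.lookup f e * (\<Prod>i\<in>UNIV. (v $ i) ^ Poly_Mapping.lookup e i)) (mdeg e))"

lemma mdeg_add: "mdeg (a + b) = mdeg a + mdeg b"
  by (simp add: mdeg_def lookup_add sum.distrib)

lemma mdeg_single [simp]: "mdeg (Poly_Mapping.single k n) = n"
  by (simp add: mdeg_def lookup_single when_def)

lemma line_eval_0 [simp]: "line_eval v 0 = 0"
  by (simp add: line_eval_def)

lemma line_eval_add: "line_eval v (f + g) = line_eval v f + line_eval v g"
  unfolding line_eval_def
  by (rule setsum_keys_plus_distrib) (simp_all add: distrib_right add_monom)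

lemma line_eval_single:
  "line_eval v (Poly_Mapping.single e c) =
    Polynomial.monom (c * (\<Prod>i\<in>UNIV. (v $ i) ^ Poly_Mapping.lookup e i)) (mdeg e)"
  by (simp add: line_eval_def)

lemma line_eval_sum: "line_eval v (sum f A) = (\<Sum>x\<in>A. line_eval v (f x))"
  by (induction A rule: infinite_finite_induct) (simp_all add: line_eval_add)

lemma mpoly_sum_terms:
  "(f :: ('n::finite, 'a::field) mpoly) =
    (\<Sum>e\<in>Poly_Mapping.keys f. Poly_Mapping.single e (Poly_Mapping.lookup f e))"
  by (rule poly_mapping_eqI) (simp add: lookup_sum lookup_single when_def in_keys_iff)

lemma line_eval_mult:
  fixes f g :: "('n::finite, 'a::field) mpoly"
  shows "line_eval v (f * g) = line_eval v f * line_eval v g"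
proof -
  have single: "line_eval v (Poly_Mapping.single a b * Poly_Mapping.single c d) =
      line_eval v (Poly_Mapping.single a b) * line_eval v (Poly_Mapping.single c d)" for a b c d
    by (simp add: mult_single line_eval_single mult_monom mdeg_add lookup_add power_add
        prod.distrib mult_ac)
  let ?s = "\<lambda>h e. Poly_Mapping.single e (Poly_Mapping.lookup h e) :: ('n, 'a) mpoly"
  have "line_eval v (f * g) =
      line_eval v ((\<Sum>e\<in>Poly_Mapping.keys f. ?s f e) * (\<Sum>e\<in>Poly_Mapping.keys g. ?s g e))"
    by (simp only: mpoly_sum_terms[symmetric])
  also have "\<dots> = line_eval v (\<Sum>e\<in>Poly_Mapping.keys f. ?s f e) *
      line_eval v (\<Sum>e\<in>Poly_Mapping.keys g. ?s g e)"
    by (simp only: sum_product line_eval_sum single)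
  also have "\<dots> = line_eval v f * line_eval v g"
    by (simp only: mpoly_sum_terms[symmetric])
  finally show ?thesis .
qed

lemma line_eval_1 [simp]: "line_eval v 1 = 1"
  using line_eval_single[of v 0 1] by (simp add: mdeg_def flip: single_one)

lemma line_eval_minus: "line_eval v (f - g) = line_eval v f - line_eval v g"
  using line_eval_add[of v "f - g" g] by (simp add: algebra_simps)

lemma eval_mpoly_eq_poly: "eval_mpoly f v = poly (line_eval v f) 1"
  by (simp add: eval_mpoly_def line_eval_def poly_sum poly_monom)

lemma line_eval_hom:
  assumes "f \<in> hom_part d"
  shows "line_eval v f = Polynomial.monom (eval_mpoly f v) d"
proof -
  have "line_eval v f = (\<Sum>e\<in>Poly_Mapping.keys f.
     Polynomial.monom (Poly_Mapping.lookup f e * (\<Prod>i\<in>UNIV. (v $ i) ^ Poly_Mapping.lookup e i)) d)"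
    unfolding line_eval_def using assms by (intro sum.cong) (auto simp: hom_part_def)
  then show ?thesis by (simp add: eval_mpoly_def monom_sum)
qed

text \<open>
  A coordinate \<open>t\<^sub>k\<close> that is non-zero at \<open>v\<close> restricts to a non-zero multiple of \<open>t\<close>.
\<close>

lemma surj_line_eval:
  assumes "v \<noteq> 0"
  shows "surj (line_eval v)"
proof -
  obtain k where k: "v $ k \<noteq> 0" using assms by (auto simp: vec_eq_iff)
  have mono: "line_eval v (Poly_Mapping.single (Poly_Mapping.single k n) (c / v $ k ^ n)) = Polynomial.monom c n"
    for c n
  proof -
    have "(\<Prod>i\<in>UNIV. v $ i ^ Poly_Mapping.lookup (Poly_Mapping.single k n) i) = (\<Prod>i\<in>UNIV. if i = k then v $ k ^ n else 1)"
      by (intro prod.cong) (auto simp: lookup_single when_def)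
    then show ?thesis using k by (simp add: line_eval_single)
  qed
  have "\<exists>f. p = line_eval v f" for p
    by (rule exI[of _ "\<Sum>n\<le>Polynomial.degree p. Poly_Mapping.single (Poly_Mapping.single k n) (Polynomial.coeff p n / v $ k ^ n)"])
      (simp add: line_eval_sum mono poly_as_sum_of_monoms)
  then show ?thesis unfolding surj_def by blast
qed

lemma hom_part_mult:
  assumes f: "f \<in> hom_part a" and g: "g \<in> hom_part b"
  shows "f * g \<in> hom_part (a + b)"
  unfolding hom_part_def
proof (intro CollectI ballI)
  fix e assume "e \<in> Poly_Mapping.keys (f * g)"
  then obtain x y where "e = x + y" "x \<in> Poly_Mapping.keys f" "y \<in> Poly_Mapping.keys g"
    using keys_mult[of f g] by blast
  then show "mdeg e = a + b" using f g by (simp add: hom_part_def mdeg_add)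
qed

lemma subspace_hom_part: "mp.subspace (hom_part d :: ('n::finite, 'a::field) mpoly set)"
proof -
  have c: "(Poly_Mapping.single 0 c :: ('n, 'a) mpoly) \<in> hom_part 0" for c by (auto simp: hom_part_def mdeg_def)
  have "f + g \<in> hom_part d" if "f \<in> hom_part d" "g \<in> hom_part d" for f g :: "('n, 'a) mpoly"
    using that Poly_Mapping.keys_add[of f g] by (auto simp: hom_part_def)
  moreover have "mscale c f \<in> hom_part d" if "f \<in> hom_part d" for c and f :: "('n, 'a) mpoly"
    using hom_part_mult[OF c that] by (simp add: mscale_def)
  moreover have "(0 :: ('n, 'a) mpoly) \<in> hom_part d" by (simp add: hom_part_def)
  ultimately show ?thesis unfolding mp.subspace_def by blast
qed

definition hom_comp :: "nat \<Rightarrow> ('n::finite, 'a::field) mpoly \<Rightarrow> ('n, 'a) mpoly"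
  where "hom_comp d f = (\<Sum>e | e \<in> Poly_Mapping.keys f \<and> mdeg e = d. Poly_Mapping.single e (Poly_Mapping.lookup f e))"

lemma hom_comp_in_hom_part: "hom_comp d (f :: ('n::finite, 'a::field) mpoly) \<in> hom_part d"
proof -
  have "(Poly_Mapping.single e c :: ('n, 'a) mpoly) \<in> hom_part (mdeg e)" for e c by (auto simp: hom_part_def)
  then show ?thesis
    unfolding hom_comp_def by (intro mp.subspace_sum[OF subspace_hom_part]) auto
qed

lemma sum_hom_comp: "f = (\<Sum>d\<in>mdeg ` Poly_Mapping.keys f. hom_comp d f)"
  unfolding hom_comp_def
  by (rule trans[OF mpoly_sum_terms sum.image_gen]) (rule finite_keys)

lemma line_eval_eq_0_iff:
  "line_eval v f = 0 \<longleftrightarrow> (\<forall>d. eval_mpoly (hom_comp d f) v = 0)"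
proof
  have eq: "line_eval v f = (\<Sum>d\<in>mdeg ` Poly_Mapping.keys f. Polynomial.monom (eval_mpoly (hom_comp d f) v) d)"
    by (rule trans[OF arg_cong[OF sum_hom_comp]])
      (simp add: line_eval_sum line_eval_hom[OF hom_comp_in_hom_part])
  show "line_eval v f = 0" if "\<forall>d. eval_mpoly (hom_comp d f) v = 0" using that by (simp add: eq)
  show "\<forall>d. eval_mpoly (hom_comp d f) v = 0" if 0: "line_eval v f = 0"
  proof
    fix d
    show "eval_mpoly (hom_comp d f) v = 0"
    proof (cases "d \<in> mdeg ` Poly_Mapping.keys f")
      case True
      then show ?thesis using arg_cong[OF trans[OF eq[symmetric] 0], of "\<lambda>p. Polynomial.coeff p d"]
        by (simp add: Polynomial.coeff_sum)
    next
      case False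
      then have "hom_comp d f = 0" by (auto simp: hom_comp_def intro!: sum.neutral)
      then show ?thesis by (simp add: eval_mpoly_def)
    qed
  qed
qed

section \<open>Ideals of a ring given by a type class\<close>

lemma ring_of_type_simps:
  "carrier (ring_of_type_algebra :: 'b::comm_ring_1 ring) = UNIV"
  "x \<otimes>\<^bsub>ring_of_type_algebra\<^esub> y = x * (y :: 'b)"
  "x \<oplus>\<^bsub>ring_of_type_algebra\<^esub> y = x + (y :: 'b)"
  "\<one>\<^bsub>ring_of_type_algebra\<^esub> = (1 :: 'b)"
  "\<zero>\<^bsub>ring_of_type_algebra\<^esub> = (0 :: 'b)"
  by (simp_all add: ring_of_type_algebra_def)

lemma a_inv_ring_of_type: "\<ominus>\<^bsub>ring_of_type_algebra\<^esub> x = - (x :: 'b::comm_ring_1)"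
proof -
  interpret cring "ring_of_type_algebra :: 'b ring" by (rule cring_from_type_algebra)
  show ?thesis by (rule minus_equality) (simp_all add: ring_of_type_simps)
qed

lemma ideal_of_typeI:
  fixes J :: "'b::comm_ring_1 set"
  assumes "0 \<in> J" "\<And>x y. x \<in> J \<Longrightarrow> y \<in> J \<Longrightarrow> x + y \<in> J" "\<And>x y. x \<in> J \<Longrightarrow> y * x \<in> J"
  shows "ideal J ring_of_type_algebra"
proof (rule idealI)
  have neg: "- x \<in> J" if "x \<in> J" for x using assms(3)[OF that, of "-1"] by simp
  show "subgroup J (add_monoid (ring_of_type_algebra :: 'b ring))"
  proof -
    interpret cring "ring_of_type_algebra :: 'b ring" by (rule cring_from_type_algebra)
    show ?thesis
      using assms(1,2) neg
      by (intro add.subgroupI) (auto simp: ring_of_type_simps a_inv_ring_of_type simp flip: a_inv_def)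
  qed
qed (use assms in \<open>auto simp: ring_of_type_simps mult.commute intro: ring_from_type_algebra\<close>)

lemma ideal_of_typeD:
  fixes J :: "'b::comm_ring_1 set"
  assumes "ideal J ring_of_type_algebra"
  shows "0 \<in> J" "\<And>x y. x \<in> J \<Longrightarrow> y \<in> J \<Longrightarrow> x + y \<in> J" "\<And>x y. x \<in> J \<Longrightarrow> y * x \<in> J"
    "\<And>x y. x \<in> J \<Longrightarrow> y \<in> J \<Longrightarrow> x - y \<in> J"
proof -
  interpret ideal J "ring_of_type_algebra :: 'b ring" by (rule assms)
  show "0 \<in> J" using additive_subgroup.zero_closed[OF is_additive_subgroup] by (simp add: ring_of_type_simps)
  show add: "x + y \<in> J" if "x \<in> J" "y \<in> J" for x y
    using additive_subgroup.a_closed[OF is_additive_subgroup that] by (simp add: ring_of_type_simps)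
  show mult: "y * x \<in> J" if "x \<in> J" for x y
    using I_l_closed[OF that, of y] by (simp add: ring_of_type_simps)
  show "x - y \<in> J" if "x \<in> J" "y \<in> J" for x y
    using add[OF that(1) mult[OF that(2), of "-1"]] by simp
qed

lemma primeideal_of_typeD:
  fixes Q :: "'b::comm_ring_1 set"
  assumes "primeideal Q ring_of_type_algebra"
  shows "ideal Q ring_of_type_algebra" "1 \<notin> Q" "\<And>x y. x * y \<in> Q \<Longrightarrow> x \<in> Q \<or> y \<in> Q"
proof -
  interpret primeideal Q "ring_of_type_algebra :: 'b ring" by (rule assms)
  show id: "ideal Q ring_of_type_algebra" by (rule is_ideal)
  show "1 \<notin> Q"
    using I_notcarr ideal_of_typeD(3)[OF id, of 1] by (auto simp: ring_of_type_simps)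
  show "x \<in> Q \<or> y \<in> Q" if "x * y \<in> Q" for x y
    using I_prime[of x y] that by (simp add: ring_of_type_simps)
qed

section \<open>Intersections of line ideals and the primes above them\<close>

lemma line_eval_ring_hom:
  "ring_hom_ring \<S> (ring_of_type_algebra :: 'a::field poly ring) (line_eval (v :: 'a ^ 'n::finite))"
  by (rule ring_hom_ringI2[OF ring_from_type_algebra ring_from_type_algebra], rule ring_hom_memI)
    (simp_all add: ring_of_type_simps line_eval_mult line_eval_add)

text \<open>
  The polynomials vanishing on all lines \<open>K v\<close>, \<open>v \<in> A\<close>, in the strong sense that the restriction is
  the zero polynomial: over a finite field, a polynomial may vanish at every point of a line without
  lying in the homogeneous vanishing ideal of the line.
\<close>

definition line_ideal :: "('a::field ^ 'n::finite) set \<Rightarrow> ('n, 'a) mpoly set"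
  where "line_ideal A = {f. \<forall>v\<in>A. line_eval v f = 0}"

lemma ideal_line_ideal: "ideal (line_ideal A) \<S>"
  by (rule ideal_of_typeI) (simp_all add: line_ideal_def line_eval_add line_eval_mult)

text \<open>
  If \<open>Q\<close> contained none of the kernels, it would miss some \<open>g v\<close> in the kernel for each \<open>v\<close>. The product
  of the \<open>g v\<close> lies in every kernel, hence in \<open>Q\<close>, against primality.
\<close>

lemma prime_above_line_ideal:
  assumes "finite A" and Q: "primeideal Q \<S>" and sub: "line_ideal A \<subseteq> Q"
  shows "\<exists>v\<in>A. line_ideal {v} \<subseteq> Q"
proof (rule ccontr)
  assume "\<not> ?thesis"
  then have "\<forall>v\<in>A. \<exists>f. f \<in> line_ideal {v} \<and> f \<notin> Q" by blast
  then obtain g where g: "\<And>v. v \<in> A \<Longrightarrow> g v \<in> line_ideal {v} \<and> g v \<notin> Q" by metis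
  have "(\<Prod>v\<in>B. g v) \<notin> Q" if "B \<subseteq> A" for B
    using finite_subset[OF that \<open>finite A\<close>] that
  proof (induction B rule: finite_induct)
    case empty
    then show ?case using primeideal_of_typeD(2)[OF Q] by simp
  next
    case (insert v B)
    then show ?case using primeideal_of_typeD(3)[OF Q, of "g v" "prod g B"] g[of v] by auto
  qed
  moreover have "(\<Prod>v\<in>A. g v) \<in> line_ideal A"
    unfolding line_ideal_def
  proof (intro CollectI ballI)
    fix v assume "v \<in> A"
    then have "line_eval v (\<Prod>v\<in>A. g v) = line_eval v (g v) * line_eval v (\<Prod>v\<in>A - {v}. g v)"
      using \<open>finite A\<close> by (simp add: prod.remove line_eval_mult)
    then show "line_eval v (\<Prod>v\<in>A. g v) = 0" using g[OF \<open>v \<in> A\<close>] by (simp add: line_ideal_def)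
  qed
  ultimately show False using sub by blast
qed

text \<open>
  The image of an ideal under a surjection onto \<open>K[t]\<close> is an ideal, hence principal: an element of least
  degree generates it, by division with remainder.
\<close>

lemma line_image_principal:
  assumes "v \<noteq> 0" and J: "ideal J \<S>" and ne: "f \<in> J" "line_eval v f \<noteq> 0"
  obtains g where "g \<in> J" "line_eval v g \<noteq> 0" "\<And>x. x \<in> J \<Longrightarrow> \<exists>y. line_eval v x = line_eval v (y * g)"
proof -
  define R where "R g \<longleftrightarrow> g \<in> J \<and> line_eval v g \<noteq> 0" for g
  obtain g where g: "R g" and min: "\<And>x. R x \<Longrightarrow> Polynomial.degree (line_eval v g) \<le> Polynomial.degree (line_eval v x)"
    using ex_has_least_nat[of R f "\<lambda>g. Polynomial.degree (line_eval v g)"] ne unfolding R_def by blast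
  have "\<exists>y. line_eval v x = line_eval v (y * g)" if x: "x \<in> J" for x
  proof -
    obtain y where y: "line_eval v y = line_eval v x div line_eval v g"
      using surj_line_eval[OF \<open>v \<noteq> 0\<close>] by (metis surjD)
    have r: "line_eval v (x - y * g) = line_eval v x mod line_eval v g"
      by (simp add: line_eval_minus line_eval_mult y minus_div_mult_eq_mod)
    have "x - y * g \<in> J" using ideal_of_typeD(3,4)[OF J] x g unfolding R_def by blast
    then have "line_eval v (x - y * g) = 0"
      using min[of "x - y * g"] degree_mod_less[of "line_eval v g" "line_eval v x"] g
      unfolding R_def r by fastforce
    then show ?thesis by (auto simp: line_eval_minus intro: exI[of _ y])
  qed
  then show ?thesis using that g unfolding R_def by blast
qed

text \<open>
  The primes above the kernel of the restriction to a line correspond to those of \<open>K[t]\<close>, where a non-zero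
  prime ideal is maximal. The proof compares generators \<open>g1\<close>, \<open>g2\<close> of the images of \<open>Q1 \<subset> Q2\<close>: writing
  \<open>g1 = c * g2\<close>, one of the factors lies in \<open>Q1\<close>. If it is \<open>g2\<close>, the two ideals agree; if it is \<open>c\<close>, then
  \<open>g2\<close> restricts to a unit.
\<close>

lemma no_chain_above_line_ideal:
  fixes v :: "'a::field ^ 'n::finite"
  assumes v: "v \<noteq> 0" and sub: "line_ideal {v} \<subseteq> Q0" and lt: "Q0 \<subset> Q1" "Q1 \<subset> Q2"
    and Q1: "primeideal Q1 \<S>" and Q2: "primeideal Q2 \<S>"
  shows False
proof -
  note I1 = ideal_of_typeD[OF primeideal_of_typeD(1)[OF Q1]]
  note I2 = ideal_of_typeD[OF primeideal_of_typeD(1)[OF Q2]]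
  have ker: "x \<in> Q1" if "y \<in> Q1" "line_eval v x = line_eval v y" for x y
  proof -
    have "x - y \<in> line_ideal {v}" using that by (simp add: line_ideal_def line_eval_minus)
    then have "x - y \<in> Q1" using sub lt by blast
    from I1(2)[OF this that(1)] show ?thesis by simp
  qed
  obtain f where f: "f \<in> Q1" "line_eval v f \<noteq> 0" using sub lt by (auto simp: line_ideal_def)
  obtain g1 where g1: "g1 \<in> Q1" "line_eval v g1 \<noteq> 0"
    and gen1: "\<And>x. x \<in> Q1 \<Longrightarrow> \<exists>y. line_eval v x = line_eval v (y * g1)"
    using line_image_principal[OF v primeideal_of_typeD(1)[OF Q1] f] by metis
  have "f \<in> Q2" using f lt by blast
  then obtain g2 where g2: "g2 \<in> Q2"
    and gen2: "\<And>x. x \<in> Q2 \<Longrightarrow> \<exists>y. line_eval v x = line_eval v (y * g2)"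
    using line_image_principal[OF v primeideal_of_typeD(1)[OF Q2] _ f(2)] by metis
  obtain c where c: "line_eval v g1 = line_eval v (c * g2)" using gen2 g1 lt by blast
  have "c * g2 \<in> Q1" using ker[OF g1(1)] c by simp
  then consider "g2 \<in> Q1" | "c \<in> Q1" using primeideal_of_typeD(3)[OF Q1] by blast
  then show False
  proof cases
    case 1
    have "x \<in> Q1" if "x \<in> Q2" for x
      using gen2[OF that] ker[OF I1(3)[OF 1]] by blast
    then show False using lt by blast
  next
    case 2
    then obtain d where d: "line_eval v c = line_eval v (d * g1)" using gen1 by blast
    have alg: "a * (1 - b * e) = a - b * a * e" for a b e :: "'a poly"
      by (simp add: algebra_simps)
    have "line_eval v g1 = line_eval v d * line_eval v g1 * line_eval v g2"
      using c unfolding line_eval_mult[of v c] d unfolding line_eval_mult .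
    then have "line_eval v g1 * (1 - line_eval v d * line_eval v g2) = 0"
      unfolding alg right_minus_eq .
    then have "line_eval v (1 - d * g2) = 0" using g1(2) by (simp add: line_eval_minus line_eval_mult)
    then have "1 - d * g2 \<in> line_ideal {v}" by (simp add: line_ideal_def)
    then have "1 - d * g2 \<in> Q2" using sub lt by blast
    from I2(2)[OF this I2(3)[OF g2, of d]] show False using primeideal_of_typeD(2)[OF Q2] by simp
  qed
qed

section \<open>Krull dimension of the quotients\<close>

lemma carrier_quot_of_type:
  "carrier (ring_of_type_algebra Quot J) = range (\<lambda>x. J +>\<^bsub>ring_of_type_algebra\<^esub> (x :: 'b::comm_ring_1))"
  by (simp only: FactRing_def A_RCOSETS_def' ring_of_type_simps partial_object.simps UNION_singleton_eq_range)

lemma zero_one_quot: "\<zero>\<^bsub>R Quot J\<^esub> = J" "\<one>\<^bsub>R Quot J\<^esub> = J +>\<^bsub>R\<^esub> \<one>\<^bsub>R\<^esub>"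
  by (simp_all add: FactRing_def)

text \<open>
  A strict chain of primes of \<open>S/J\<close> pulls back to a strict chain of primes of \<open>S\<close> above \<open>J\<close>. Its
  smallest member contains a single line ideal, and then the chain has at most two members.
\<close>

lemma krull_dim_quot_le_1:
  assumes "finite A" and nz: "0 \<notin> A" and J: "ideal J \<S>" and sub: "line_ideal A \<subseteq> J"
  shows "krull_dim (\<S> Quot J) \<le> 1"
proof -
  interpret J: ideal J \<S> by (rule J)
  interpret pi: ring_hom_ring \<S> "\<S> Quot J" "(+>\<^bsub>\<S>\<^esub>) J" by (rule J.rcos_ring_hom_ring)
  have "n \<le> 1" if pr: "\<forall>i\<le>n. primeideal (Q i) (\<S> Quot J)" and lt: "\<forall>i<n. Q i \<subset> Q (Suc i)" for n Q
  proof (rule ccontr)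
    assume "\<not> n \<le> 1"
    define R where "R i = {r. J +>\<^bsub>\<S>\<^esub> r \<in> Q i}" for i
    have prR: "primeideal (R i) \<S>" if "i \<le> n" for i
      using pi.primeideal_vimage[OF cring_from_type_algebra, of "Q i"] pr that
      by (simp only: R_def ring_of_type_simps UNIV_I simp_thms)
    have ltR: "R i \<subset> R (Suc i)" if "i < n" for i
    proof -
      have lti: "Q i \<subset> Q (Suc i)" by (rule lt[rule_format, OF that])
      then obtain C where C: "C \<in> Q (Suc i)" "C \<notin> Q i" by blast
      have "ideal (Q (Suc i)) (\<S> Quot J)" using pr[rule_format, of "Suc i"] that unfolding primeideal_def by (simp only: Suc_leI)
      then have "C \<in> carrier (\<S> Quot J)" using C(1) by (rule ideal.Icarr)
      then obtain x where x: "C = J +>\<^bsub>\<S>\<^esub> x" unfolding carrier_quot_of_type by (rule imageE)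
      have "x \<in> R (Suc i)" "x \<notin> R i" using C by (simp_all add: R_def x)
      moreover have "R i \<subseteq> R (Suc i)" unfolding R_def using lti by blast
      ultimately show ?thesis by blast
    qed
    have "J \<subseteq> R 0"
    proof
      fix x assume "x \<in> J"
      then have "J +>\<^bsub>\<S>\<^esub> x = \<zero>\<^bsub>\<S> Quot J\<^esub>" by (simp only: J.a_rcos_const zero_one_quot)
      moreover have "\<zero>\<^bsub>\<S> Quot J\<^esub> \<in> Q 0"
        using pr[rule_format, of 0] unfolding primeideal_def by (simp add: additive_subgroup.zero_closed ideal.axioms(1))
      ultimately show "x \<in> R 0" by (simp add: R_def)
    qed
    then have "line_ideal A \<subseteq> R 0" using sub by (rule subset_trans[rotated])
    then obtain v where v: "v \<in> A" "line_ideal {v} \<subseteq> R 0"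
      using prime_above_line_ideal[OF \<open>finite A\<close> prR[of 0]] by blast
    have "0 < n" "1 < n" "1 \<le> n" "2 \<le> n" using \<open>\<not> n \<le> 1\<close> by simp_all
    then have "R 0 \<subset> R 1" "R 1 \<subset> R 2" "primeideal (R 1) \<S>" "primeideal (R 2) \<S>"
      using ltR[of 0] ltR[of 1] prR by (simp_all add: numeral_2_eq_2)
    moreover have "v \<noteq> 0" using nz v(1) by metis
    ultimately show False using no_chain_above_line_ideal v(2) by metis
  qed
  then show ?thesis
    unfolding krull_dim_def by (intro SUP_least) (auto simp: one_enat_def)
qed

lemma line_eval_coset:
  assumes J: "ideal J \<S>" and sub: "J \<subseteq> line_ideal {v}"
  shows "line_eval v ` (J +>\<^bsub>\<S>\<^esub> x) = {line_eval v x}"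
proof -
  have "J +>\<^bsub>\<S>\<^esub> x = (\<lambda>j. j + x) ` J"
    by (simp only: a_r_coset_def' ring_of_type_simps UNION_singleton_eq_range)
  moreover have "line_eval v (j + x) = line_eval v x" if "j \<in> J" for j
    using sub that by (auto simp: line_eval_add line_ideal_def)
  ultimately show ?thesis using ideal_of_typeD(1)[OF J] by (auto simp: image_image)
qed

lemma primeideal_zero_poly: "primeideal {0} (ring_of_type_algebra :: 'a::field poly ring)"
proof (rule primeidealI[OF ideal_of_typeI cring_from_type_algebra])
  have "(1 :: 'a poly) \<notin> {0}" by simp
  then show "carrier ring_of_type_algebra \<noteq> {0 :: 'a poly}"
    unfolding ring_of_type_simps by blast
qed (simp_all add: ring_of_type_simps)

lemma primeideal_root_poly:
  "primeideal {p. poly p a = 0} (ring_of_type_algebra :: 'a::field poly ring)"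
proof (rule primeidealI[OF ideal_of_typeI cring_from_type_algebra])
  have "(1 :: 'a poly) \<notin> {p. poly p a = 0}" by simp
  then show "carrier ring_of_type_algebra \<noteq> {p. poly p a = 0}"
    unfolding ring_of_type_simps by blast
qed (simp_all add: ring_of_type_simps)

lemma line_eval_induced_hom:
  assumes J: "ideal J \<S>" and sub: "J \<subseteq> line_ideal {v :: 'a::field ^ 'n::finite}"
  obtains \<psi> where "ring_hom_ring (\<S> Quot J) (ring_of_type_algebra :: 'a poly ring) \<psi>"
    and "\<And>x. \<psi> (J +>\<^bsub>\<S>\<^esub> x) = line_eval v x"
proof
  let ?K = "ring_of_type_algebra :: 'a poly ring"
  let ?\<psi> = "\<lambda>C. the_elem (line_eval v ` C)"
  note hom = ideal.rcos_ring_hom[OF J]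
  show psi: "?\<psi> (J +>\<^bsub>\<S>\<^esub> x) = line_eval v x" for x
    by (simp only: line_eval_coset[OF J sub] the_elem_eq)
  show "ring_hom_ring (\<S> Quot J) ?K ?\<psi>"
  proof (rule ring_hom_ringI2[OF ideal.quotient_is_ring[OF J] ring_from_type_algebra], rule ring_hom_memI)
    fix C D assume "C \<in> carrier (\<S> Quot J)" "D \<in> carrier (\<S> Quot J)"
    then obtain x y where C: "C = J +>\<^bsub>\<S>\<^esub> x" and D: "D = J +>\<^bsub>\<S>\<^esub> y"
      unfolding carrier_quot_of_type by blast
    show "?\<psi> C \<in> carrier ?K" by (simp only: ring_of_type_simps UNIV_I)
    have "C \<otimes>\<^bsub>\<S> Quot J\<^esub> D = J +>\<^bsub>\<S>\<^esub> (x * y)" "C \<oplus>\<^bsub>\<S> Quot J\<^esub> D = J +>\<^bsub>\<S>\<^esub> (x + y)"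
      using ring_hom_mult[OF hom, of x y] ring_hom_add[OF hom, of x y]
      by (simp_all only: C D ring_of_type_simps UNIV_I simp_thms)
    then show "?\<psi> (C \<otimes>\<^bsub>\<S> Quot J\<^esub> D) = ?\<psi> C \<otimes>\<^bsub>?K\<^esub> ?\<psi> D" "?\<psi> (C \<oplus>\<^bsub>\<S> Quot J\<^esub> D) = ?\<psi> C \<oplus>\<^bsub>?K\<^esub> ?\<psi> D"
      by (simp_all only: C D psi ring_of_type_simps line_eval_mult line_eval_add)
  next
    show "?\<psi> \<one>\<^bsub>\<S> Quot J\<^esub> = \<one>\<^bsub>?K\<^esub>"
      by (simp only: zero_one_quot psi ring_of_type_simps line_eval_1)
  qed
qed

text \<open>
  The restriction to the line induces a surjection of \<open>S/J\<close> onto \<open>K[t]\<close>. The chain \<open>0 \<subset> (t)\<close> of primes of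
  \<open>K[t]\<close> pulls back to a chain of length 1.
\<close>

lemma krull_dim_quot_ge_1:
  assumes "v \<noteq> 0" and J: "ideal J \<S>" and sub: "J \<subseteq> line_ideal {v :: 'a::field ^ 'n::finite}"
  shows "krull_dim (\<S> Quot J) \<ge> 1"
proof -
  obtain \<psi> where hom: "ring_hom_ring (\<S> Quot J) (ring_of_type_algebra :: 'a poly ring) \<psi>"
    and psi: "\<And>x. \<psi> (J +>\<^bsub>\<S>\<^esub> x) = line_eval v x"
    using line_eval_induced_hom[OF J sub] by blast
  define Q where "Q A = {C \<in> carrier (\<S> Quot J). \<psi> C \<in> A}" for A
  have prime: "primeideal (Q A) (\<S> Quot J)" if "primeideal A ring_of_type_algebra" for A
    unfolding Q_def
    by (rule ring_hom_ring.primeideal_vimage[OF hom ideal.quotient_is_cring[OF J cring_from_type_algebra] that])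
  let ?m = "{p :: 'a poly. poly p 0 = 0}"
  have "Q {0} \<subset> Q ?m"
  proof (rule psubsetI)
    show "Q {0} \<subseteq> Q ?m" unfolding Q_def by (rule Collect_mono) simp
    obtain f where f: "line_eval v f = [:0, 1:]" using surj_line_eval[OF \<open>v \<noteq> 0\<close>] by (metis surjD)
    have "J +>\<^bsub>\<S>\<^esub> f \<in> carrier (\<S> Quot J)" unfolding carrier_quot_of_type by (rule rangeI)
    then have "J +>\<^bsub>\<S>\<^esub> f \<in> Q ?m" "J +>\<^bsub>\<S>\<^esub> f \<notin> Q {0}" unfolding Q_def mem_Collect_eq psi f by simp_all
    then show "Q {0} \<noteq> Q ?m" by metis
  qed
  then have "\<exists>Q'. (\<forall>i\<le>1. primeideal (Q' i) (\<S> Quot J)) \<and> (\<forall>i<1. Q' i \<subset> Q' (Suc i))"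
    using prime[OF primeideal_zero_poly] prime[OF primeideal_root_poly]
    by (intro exI[of _ "\<lambda>i::nat. if i = 0 then Q {0} else Q ?m"]) simp
  then show ?thesis
    unfolding krull_dim_def one_enat_def by (intro SUP_upper) (rule CollectI)
qed

section \<open>Values of forms and dimensions of quotients\<close>

lemma eval_mpoly_add: "eval_mpoly (f + g) v = eval_mpoly f v + eval_mpoly g v"
  by (simp add: eval_mpoly_eq_poly line_eval_add)

lemma eval_mpoly_minus: "eval_mpoly (f - g) v = eval_mpoly f v - eval_mpoly g v"
  by (simp add: eval_mpoly_eq_poly line_eval_minus)

lemma eval_mpoly_mult: "eval_mpoly (f * g) v = eval_mpoly f v * eval_mpoly g v"
  by (simp add: eval_mpoly_eq_poly line_eval_mult)

lemma eval_mpoly_single: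
  "eval_mpoly (Poly_Mapping.single e c) v = c * (\<Prod>i\<in>UNIV. (v $ i) ^ Poly_Mapping.lookup e i)"
  by (simp add: eval_mpoly_eq_poly line_eval_single poly_monom)

lemma eval_mpoly_scale: "eval_mpoly (mscale c f) v = c * eval_mpoly f v"
  by (simp add: mscale_def eval_mpoly_mult eval_mpoly_single)

lemma eval_mpoly_sum: "eval_mpoly (sum f A) v = (\<Sum>x\<in>A. eval_mpoly (f x) v)"
  by (simp add: eval_mpoly_eq_poly line_eval_sum poly_sum)

lemma eval_mpoly_prod: "eval_mpoly (prod f A) v = (\<Prod>x\<in>A. eval_mpoly (f x) v)"
  by (induction A rule: infinite_finite_induct)
    (simp_all add: eval_mpoly_mult, simp_all add: eval_mpoly_eq_poly)

lemma hom_part_prod: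
  assumes "\<And>x. x \<in> A \<Longrightarrow> f x \<in> hom_part 1"
  shows "prod f A \<in> hom_part (card A)"
  using assms
proof (induction A rule: infinite_finite_induct)
  case (insert x A)
  then have "f x * prod f A \<in> hom_part (1 + card A)" by (intro hom_part_mult) simp_all
  then show ?case using insert by simp
qed (simp_all add: hom_part_def mdeg_def)

definition linear_form :: "'n::finite \<Rightarrow> ('n, 'a::field) mpoly"
  where "linear_form k = Poly_Mapping.single (Poly_Mapping.single k 1) 1"

lemma linear_form_hom: "linear_form k \<in> hom_part 1"
  by (simp add: linear_form_def hom_part_def)

lemma eval_linear_form: "eval_mpoly (linear_form k) v = v $ k"
proof -
  have "(\<Prod>i\<in>UNIV. v $ i ^ Poly_Mapping.lookup (Poly_Mapping.single k 1) i) =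
      (\<Prod>i\<in>UNIV. if i = k then v $ k else 1)"
    by (intro prod.cong) (simp_all add: lookup_single when_def)
  then show ?thesis by (simp add: linear_form_def eval_mpoly_single)
qed

interpretation ev: vector_space_pair
  "mscale :: 'a::field \<Rightarrow> ('n::finite, 'a) mpoly \<Rightarrow> ('n, 'a) mpoly"
  "vscale :: 'a \<Rightarrow> (nat \<Rightarrow> 'a) \<Rightarrow> nat \<Rightarrow> 'a"
  ..

lemma linear_image_span:
  fixes T :: "('n::finite, 'a::field) mpoly \<Rightarrow> nat \<Rightarrow> 'a"
  assumes T: "Vector_Spaces.linear mscale vscale T"
  shows "T ` mp.span B = vc.span (T ` B)"
  using ev.linear_span_image[OF T] by simp

text \<open>
  If \<open>W\<close> is the kernel of \<open>T\<close> on \<open>V\<close>, then \<open>T\<close> embeds \<open>V/W\<close>. This turns the linear algebra of representatives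
  into ordinary linear algebra in the target of \<open>T\<close>.
\<close>

lemma indep_mod_kernel_iff:
  fixes T :: "('n::finite, 'a::field) mpoly \<Rightarrow> nat \<Rightarrow> 'a"
  assumes T: "Vector_Spaces.linear mscale vscale T" and V: "mp.subspace V"
    and W: "\<And>f. f \<in> V \<Longrightarrow> f \<in> W \<longleftrightarrow> T f = 0" and B: "B \<subseteq> V"
  shows "indep_mod W B \<longleftrightarrow> inj_on T B \<and> vc.independent (T ` B)"
proof -
  have sum: "T (\<Sum>b\<in>S. mscale (c b) b) = (\<Sum>b\<in>S. vscale (c b) (T b))" for S c
    by (simp add: ev.linear_sum[OF T] ev.linear_scale[OF T])
  have mem: "(\<Sum>b\<in>S. mscale (c b) b) \<in> W \<longleftrightarrow> (\<Sum>b\<in>S. vscale (c b) (T b)) = 0" if "S \<subseteq> B" for S c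
  proof -
    have "(\<Sum>b\<in>S. mscale (c b) b) \<in> V"
      using that B by (intro mp.subspace_sum[OF V] mp.subspace_scale[OF V]) blast
    then show ?thesis by (simp add: W sum)
  qed
  show ?thesis
  proof
    assume "indep_mod W B"
    then have ind: "\<forall>b\<in>S. c b = 0" if "finite S" "S \<subseteq> B" "(\<Sum>b\<in>S. mscale (c b) b) \<in> W" for S c
      using that unfolding indep_mod_def by simp
    have inj: "inj_on T B"
    proof (rule inj_onI, rule ccontr)
      fix x y assume xy: "x \<in> B" "y \<in> B" "T x = T y" "x \<noteq> y"
      \<comment> \<open>Two elements with the same image give the combination \<open>x - y\<close> in \<open>W\<close>.\<close>
      define c where "c b = (if b = x then 1 else -1 :: 'a)" for b
      have "(\<Sum>b\<in>{x, y}. vscale (c b) (T b)) = 0"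
        using xy by (simp add: c_def vscale_def fun_eq_iff)
      then have "(\<Sum>b\<in>{x, y}. mscale (c b) b) \<in> W" using xy mem[of "{x, y}" c] by blast
      moreover have "finite {x, y}" "{x, y} \<subseteq> B" using xy by simp_all
      ultimately have "\<forall>b\<in>{x, y}. c b = 0" using ind[of "{x, y}" c] by simp
      then show False by (simp add: c_def)
    qed
    have "\<forall>b\<in>S. c b = 0" if S: "finite S" "S \<subseteq> T ` B" "(\<Sum>b\<in>S. vscale (c b) b) = 0" for S c
    proof -
      obtain S' where S': "S' \<subseteq> B" "S = T ` S'" using S(2) by (meson subset_imageE)
      have inj': "inj_on T S'" using inj S'(1) by (rule inj_on_subset)
      have "finite S'" using S(1) S'(2) inj' finite_imageD by blast
      moreover have "(\<Sum>b\<in>S'. mscale (c (T b)) b) \<in> W"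
        using S(3) by (simp add: mem[OF S'(1)] S'(2) sum.reindex[OF inj'])
      ultimately have "\<forall>b\<in>S'. c (T b) = 0" using S'(1) ind[of S' "\<lambda>b. c (T b)"] by simp
      then show ?thesis by (simp add: S'(2))
    qed
    then have "vc.independent (T ` B)"
      unfolding vc.dependent_explicit by blast
    with inj show "inj_on T B \<and> vc.independent (T ` B)" by blast
  next
    assume *: "inj_on T B \<and> vc.independent (T ` B)"
    show "indep_mod W B"
      unfolding indep_mod_def
    proof (intro allI impI, elim conjE)
      fix S c assume S: "finite S" "S \<subseteq> B" "(\<Sum>b\<in>S. mscale (c b) b) \<in> W"
      have inj: "inj_on T S" using * S(2) inj_on_subset by blast
      have "(\<Sum>b\<in>T ` S. vscale (c (the_inv_into S T b)) b) = (\<Sum>b\<in>S. vscale (c b) (T b))"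
        by (simp add: sum.reindex[OF inj] the_inv_into_f_f[OF inj])
      also have "\<dots> = 0" using S(3) mem[OF S(2)] by blast
      finally have "c (the_inv_into S T (T b)) = 0" if "b \<in> S" for b
        using * S(1,2) that
        by (intro vc.independentD[of "T ` B" "T ` S" "\<lambda>b. c (the_inv_into S T b)"]) (simp_all add: image_mono)
      then show "\<forall>b\<in>S. c b = 0" by (simp add: the_inv_into_f_f[OF inj])
    qed
  qed
qed

text \<open>
  Bases of \<open>V/W\<close> are precisely the sets that \<open>T\<close> maps injectively onto bases of \<open>T ` V\<close>. One exists, so
  the choice in \<open>quot_dim\<close> yields a basis, and all of them have the cardinality \<open>dim (T ` V)\<close>.
\<close>

lemma quot_dim_kernel:
  fixes T :: "('n::finite, 'a::field) mpoly \<Rightarrow> nat \<Rightarrow> 'a"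
  assumes T: "Vector_Spaces.linear mscale vscale T" and V: "mp.subspace V"
    and W: "\<And>f. f \<in> V \<Longrightarrow> f \<in> W \<longleftrightarrow> T f = 0"
  shows "quot_dim V W = vc.dim (T ` V)"
proof -
  have basis: "basis_mod V W B \<longleftrightarrow> B \<subseteq> V \<and> inj_on T B \<and> vc.independent (T ` B) \<and> vc.span (T ` B) = T ` V" for B
  proof (cases "B \<subseteq> V")
    case True
    have sub: "mp.span B \<subseteq> V" using True V by (rule mp.span_minimal)
    have "(\<exists>u\<in>mp.span B. v - u \<in> W) \<longleftrightarrow> T v \<in> T ` mp.span B" if "v \<in> V" for v
    proof -
      have "v - u \<in> W \<longleftrightarrow> T v = T u" if "u \<in> mp.span B" for u
        using mp.subspace_diff[OF V \<open>v \<in> V\<close>] sub that by (simp add: W subsetD ev.linear_diff[OF T])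
      then show ?thesis by blast
    qed
    then have "(\<forall>v\<in>V. \<exists>u\<in>mp.span B. v - u \<in> W) \<longleftrightarrow> T ` mp.span B = T ` V"
      using sub by blast
    moreover have "indep_mod W B \<longleftrightarrow> inj_on T B \<and> vc.independent (T ` B)"
      by (rule indep_mod_kernel_iff[OF T V _ True]) (rule W)
    ultimately show ?thesis
      unfolding basis_mod_def linear_image_span[OF T] by simp
  qed (simp add: basis_mod_def)
  have sT: "vc.subspace (T ` V)" by (rule ev.linear_subspace_image[OF T V])
  obtain C where C: "C \<subseteq> T ` V" "vc.independent C" "T ` V \<subseteq> vc.span C"
    using vc.maximal_independent_subset by metis
  obtain B where B: "B \<subseteq> V" "inj_on T B" "C = T ` B"
    using C(1) by (metis subset_image_inj)
  have "vc.span (T ` B) = T ` V" using C(1,3) vc.span_minimal[OF C(1) sT] B(3) by blast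
  then have "basis_mod V W B" using B C(2) by (simp add: basis)
  then have "basis_mod V W (SOME B. basis_mod V W B)" by (rule someI)
  then have b: "inj_on T (SOME B. basis_mod V W B)" "vc.independent (T ` (SOME B. basis_mod V W B))"
    "vc.span (T ` (SOME B. basis_mod V W B)) = T ` V"
    unfolding basis by blast+
  have "vc.dim (T ` V) = card (T ` (SOME B. basis_mod V W B))"
    by (rule vc.dim_eq_card) (simp_all add: b vc.span_eq_iff[THEN iffD2, OF sT])
  then show ?thesis unfolding quot_dim_def by (simp add: card_image b(1))
qed

section \<open>Coordinate subspaces and supports of codes\<close>

lemma eval_mpoly_scaled_point: "eval_mpoly f (c *s v) = poly (line_eval v f) c"
  by (simp add: eval_mpoly_def line_eval_def poly_sum poly_monom mdeg_def power_sum prod.distrib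
      power_mult_distrib mult_ac)

lemma ideal_of_type_sum:
  assumes J: "ideal J (ring_of_type_algebra :: 'b::comm_ring_1 ring)" and f: "\<And>x. x \<in> A \<Longrightarrow> f x \<in> J"
  shows "sum f A \<in> J"
  using f by (induction A rule: infinite_finite_induct) (simp_all add: ideal_of_typeD(1,2)[OF J])

definition coords :: "nat set \<Rightarrow> (nat \<Rightarrow> 'a::field) set"
  where "coords A = {a. \<forall>i. i \<notin> A \<longrightarrow> a i = 0}"

definition unit_fun :: "nat \<Rightarrow> nat \<Rightarrow> 'a::field"
  where "unit_fun i = (\<lambda>j. if j = i then 1 else 0)"

lemma sum_fun_apply: "(\<Sum>x\<in>A. f x) (j :: nat) = (\<Sum>x\<in>A. f x j :: 'a::field)"
  by (induction A rule: infinite_finite_induct) simp_all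

lemma subspace_coords: "vc.subspace (coords A)"
  by (auto simp: vc.subspace_def coords_def vscale_def)

lemma coords_expansion:
  assumes "finite A" "a \<in> coords A"
  shows "a = (\<Sum>i\<in>A. vscale (a i) (unit_fun i))"
proof
  fix j
  have "(\<Sum>i\<in>A. vscale (a i) (unit_fun i)) j = (\<Sum>i\<in>A. if i = j then a j else 0)"
    by (auto simp: sum_fun_apply vscale_def unit_fun_def intro!: sum.cong)
  also have "\<dots> = a j" using assms by (simp add: coords_def)
  finally show "a j = (\<Sum>i\<in>A. vscale (a i) (unit_fun i)) j" by simp
qed

lemma span_unit_fun:
  assumes "finite A"
  shows "vc.span (unit_fun ` A) = coords A"
proof
  show "vc.span (unit_fun ` A) \<subseteq> coords A"
    by (intro vc.span_minimal subspace_coords) (auto simp: unit_fun_def coords_def)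
  show "coords A \<subseteq> vc.span (unit_fun ` A)"
  proof
    fix a :: "nat \<Rightarrow> 'b" assume "a \<in> coords A"
    then have a: "a = (\<Sum>i\<in>A. vscale (a i) (unit_fun i))" by (rule coords_expansion[OF assms])
    show "a \<in> vc.span (unit_fun ` A)"
      by (subst a) (intro vc.span_sum vc.span_scale vc.span_base imageI)
  qed
qed

lemma inj_unit_fun: "inj_on (unit_fun :: nat \<Rightarrow> nat \<Rightarrow> 'a::field) A"
  by (rule inj_onI) (metis unit_fun_def zero_neq_one)

lemma independent_unit_fun:
  assumes "finite A"
  shows "vc.independent (unit_fun ` A :: (nat \<Rightarrow> 'a::field) set)"
proof (rule vc.independent_if_scalars_zero)
  show "finite (unit_fun ` A)" using assms by simp
  fix f :: "(nat \<Rightarrow> 'a) \<Rightarrow> 'a" and x :: "nat \<Rightarrow> 'a"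
  assume 0: "(\<Sum>x\<in>unit_fun ` A. vscale (f x) x) = 0" and x: "x \<in> unit_fun ` A"
  from x obtain j where j: "j \<in> A" "x = unit_fun j" by blast
  have "(0 :: 'a) = (\<Sum>i\<in>A. vscale (f (unit_fun i)) (unit_fun i)) j"
    using 0 by (simp add: sum.reindex[OF inj_unit_fun])
  also have "\<dots> = (\<Sum>i\<in>A. if i = j then f x else 0)"
    by (auto simp: sum_fun_apply vscale_def unit_fun_def j(2) intro!: sum.cong)
  also have "\<dots> = f x" using assms j(1) by simp
  finally show "f x = 0" by simp
qed

lemma dim_coords:
  assumes "finite A"
  shows "vc.dim (coords A :: (nat \<Rightarrow> 'a::field) set) = card A"
  using vc.dim_span_eq_card_independent[OF independent_unit_fun[OF assms]]
  by (simp add: span_unit_fun[OF assms] card_image[OF inj_unit_fun])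

text \<open>
  A code lies in the coordinate subspace of its support.
\<close>

lemma dim_le_card_code_supp:
  assumes "finite (code_supp D)"
  shows "vc.dim D \<le> card (code_supp D)"
proof -
  have "D \<subseteq> vc.span (unit_fun ` code_supp D)"
    unfolding span_unit_fun[OF assms] by (auto simp: coords_def code_supp_def)
  then have "vc.dim D \<le> card (unit_fun ` code_supp D :: (nat \<Rightarrow> 'a) set)"
    using assms by (intro vc.dim_le_card) simp_all
  then show ?thesis by (simp add: card_image[OF inj_unit_fun])
qed

lemma code_supp_span: "code_supp (vc.span B) = code_supp B"
proof
  show "code_supp B \<subseteq> code_supp (vc.span B)" by (auto simp: code_supp_def intro: vc.span_base)
  have "vc.span B \<subseteq> coords (code_supp B)"
    by (intro vc.span_minimal subspace_coords) (auto simp: coords_def code_supp_def)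
  then show "code_supp (vc.span B) \<subseteq> code_supp B" by (force simp: coords_def code_supp_def)
qed

text \<open>
  The ambient space of all functions on \<open>nat\<close> is infinite-dimensional, so the comparison of dimensions is
  carried out with a basis of \<open>C\<close>: adding a vector outside \<open>C\<close> would give more than \<open>card A\<close> independent
  vectors in \<open>coords A\<close>.
\<close>

lemma full_dim_coords:
  assumes "finite A" "vc.subspace C" "C \<subseteq> coords A" "vc.dim C = card A"
  shows "C = coords A"
proof (rule ccontr)
  assume "C \<noteq> coords A"
  then obtain a where a: "a \<in> coords A" "a \<notin> C" using assms(3) by blast
  obtain B where B: "B \<subseteq> C" "vc.independent B" "C \<subseteq> vc.span B" "card B = vc.dim C"
    by (rule vc.basis_exists)
  have "vc.span B \<subseteq> C" using B(1) assms(2) by (rule vc.span_minimal)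
  then have "a \<notin> vc.span B" and aB: "a \<notin> B" using a(2) B(1) by blast+
  then have "vc.independent (insert a B)" using B(2) vc.independent_insertI by blast
  moreover have "insert a B \<subseteq> vc.span (unit_fun ` A)"
    unfolding span_unit_fun[OF assms(1)] using a(1) B(1) assms(3) by blast
  ultimately have "finite (insert a B) \<and> card (insert a B) \<le> card (unit_fun ` A :: (nat \<Rightarrow> 'a) set)"
    using assms(1) by (intro vc.independent_span_bound) simp_all
  then show False using aB B(4) assms(4) by (auto simp: card_image[OF inj_unit_fun])
qed

section \<open>Degrees of ideals defined by finitely many points\<close>

text \<open>
  Representatives of \<open>m\<close> distinct points of projective space.
\<close>

locale point_family =
  fixes P :: "nat \<Rightarrow> 'a::field ^ 'n::finite" and m :: nat
  assumes nonzero: "i \<in> {1..m} \<Longrightarrow> P i \<noteq> 0"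
    and distinct: "i \<in> {1..m} \<Longrightarrow> j \<in> {1..m} \<Longrightarrow> P i = c *s P j \<Longrightarrow> i = j"
begin

definition eval_at :: "nat set \<Rightarrow> ('n, 'a) mpoly \<Rightarrow> nat \<Rightarrow> 'a"
  where "eval_at A f = (\<lambda>i. if i \<in> A then eval_mpoly f (P i) else 0)"

lemma eval_code_eq: "eval_code m P d = eval_at {1..m} ` hom_part d"
  by (simp add: eval_code_def eval_at_def[abs_def])

lemma linear_eval_at: "Vector_Spaces.linear mscale vscale (eval_at A)"
  by (rule Vector_Spaces.linear_iff[THEN iffD2])
    (simp add: mp.vector_space_axioms vc.vector_space_axioms,
      simp add: eval_at_def vscale_def fun_eq_iff eval_mpoly_add eval_mpoly_scale)

lemma eval_at_in_coords: "eval_at A f \<in> coords A"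
  by (simp add: eval_at_def coords_def)

lemma eval_at_eq_0_iff: "eval_at A f = 0 \<longleftrightarrow> (\<forall>i\<in>A. eval_mpoly f (P i) = 0)"
  by (auto simp: eval_at_def fun_eq_iff)

lemma hom_in_line_ideal_iff:
  assumes "f \<in> hom_part d"
  shows "f \<in> line_ideal (P ` A) \<longleftrightarrow> (\<forall>i\<in>A. eval_mpoly f (P i) = 0)"
  by (simp add: line_ideal_def line_eval_hom[OF assms])

text \<open>
  If \<open>P j\<close> has a non-zero \<open>k\<close>-th entry, the linear forms \<open>P\<^sub>j\<^sub>k t\<^sub>n - P\<^sub>j\<^sub>n t\<^sub>k\<close> have \<open>K P\<^sub>j\<close> as their common
  zero set. As \<open>P i\<close> is not on this line, one of them is non-zero there.
\<close>

lemma separating_linear_form: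
  assumes "i \<in> {1..m}" "j \<in> {1..m}" "i \<noteq> j"
  obtains l where "l \<in> hom_part 1" "eval_mpoly l (P i) \<noteq> 0" "eval_mpoly l (P j) = 0"
proof -
  obtain k where k: "P j $ k \<noteq> 0" using nonzero[OF assms(2)] by (auto simp: vec_eq_iff)
  define l where "l n = mscale (P j $ k) (linear_form n) - mscale (P j $ n) (linear_form k)" for n
  have ev: "eval_mpoly (l n) v = P j $ k * v $ n - P j $ n * v $ k" for n v
    by (simp add: l_def eval_mpoly_minus eval_mpoly_scale eval_linear_form)
  have "\<exists>n. eval_mpoly (l n) (P i) \<noteq> 0"
  proof (rule ccontr)
    assume "\<not> ?thesis"
    then have eq: "P j $ k * P i $ n = P j $ n * P i $ k" for n unfolding ev by simp
    have "P i = (P i $ k / P j $ k) *s P j"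
      using eq k by (simp add: vec_eq_iff field_simps)
    then show False using distinct[OF assms(1,2)] assms(3) by blast
  qed
  then obtain n where n: "eval_mpoly (l n) (P i) \<noteq> 0" ..
  have "l n \<in> hom_part 1"
    unfolding l_def
    by (intro mp.subspace_diff mp.subspace_scale subspace_hom_part linear_form_hom)
  then show ?thesis using n by (rule that) (simp add: ev)
qed

text \<open>
  A product of \<open>m - 1\<close> separating linear forms, one for each of the other points, is non-zero at \<open>P i\<close>
  only. A power of a coordinate that is non-zero at \<open>P i\<close> raises its degree to \<open>d\<close>.
\<close>

lemma indicator_form:
  assumes i: "i \<in> {1..m}" and "m \<le> d"
  obtains f where "f \<in> hom_part d" "eval_mpoly f (P i) = 1"
    "\<And>j. j \<in> {1..m} \<Longrightarrow> j \<noteq> i \<Longrightarrow> eval_mpoly f (P j) = 0"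
proof -
  obtain k where k: "P i $ k \<noteq> 0" using nonzero[OF i] by (auto simp: vec_eq_iff)
  have "\<forall>j\<in>{1..m} - {i}. \<exists>l. l \<in> hom_part 1 \<and> eval_mpoly l (P i) \<noteq> 0 \<and> eval_mpoly l (P j) = 0"
    using separating_linear_form[OF i] by (metis DiffD1 DiffD2 singletonI)
  then obtain l where l: "\<And>j. j \<in> {1..m} - {i} \<Longrightarrow>
      l j \<in> hom_part 1 \<and> eval_mpoly (l j) (P i) \<noteq> 0 \<and> eval_mpoly (l j) (P j) = 0"
    by metis
  define q where "q = (\<Prod>j\<in>{1..m} - {i}. l j)"
  \<comment> \<open>the missing degree\<close>
  define n where "n = d - (m - 1)"
  define g where "g = q * (\<Prod>j<n. linear_form k)"
  have "q \<in> hom_part (card ({1..m} - {i}))" unfolding q_def using l by (intro hom_part_prod) blast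
  moreover have "card ({1..m} - {i}) = m - 1" using i by simp
  moreover have "(\<Prod>j<n. linear_form k) \<in> hom_part (card {..<n})"
    by (intro hom_part_prod linear_form_hom)
  ultimately have "g \<in> hom_part (m - 1 + n)" unfolding g_def by (intro hom_part_mult) simp_all
  then have g: "g \<in> hom_part d" using assms by (simp add: n_def)
  have gi: "eval_mpoly g (P i) \<noteq> 0"
    unfolding g_def q_def eval_mpoly_mult eval_mpoly_prod eval_linear_form using l k by simp
  have gj: "eval_mpoly g (P j) = 0" if "j \<in> {1..m}" "j \<noteq> i" for j
  proof -
    have "eval_mpoly q (P j) = 0"
      unfolding q_def eval_mpoly_prod using that l[of j] by (intro prod_zero bexI[of _ j]) simp_all
    then show ?thesis by (simp add: g_def eval_mpoly_mult)
  qed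
  show ?thesis
  proof (rule that)
    show "mscale (1 / eval_mpoly g (P i)) g \<in> hom_part d"
      using g by (intro mp.subspace_scale subspace_hom_part)
  qed (simp_all add: eval_mpoly_scale gi gj)
qed

lemma eval_at_surj:
  assumes A: "A \<subseteq> {1..m}" and d: "m \<le> d"
  shows "eval_at A ` hom_part d = coords A"
proof
  show "eval_at A ` hom_part d \<subseteq> coords A" using eval_at_in_coords by blast
  have fin: "finite A" using A by (rule finite_subset) simp
  have sub: "vc.subspace (eval_at A ` hom_part d)"
    by (rule ev.linear_subspace_image[OF linear_eval_at subspace_hom_part])
  have "unit_fun i \<in> eval_at A ` hom_part d" if "i \<in> A" for i
  proof -
    have "i \<in> {1..m}" using that A by blast
    then obtain f where f: "f \<in> hom_part d" "eval_mpoly f (P i) = 1"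
      "\<And>j. j \<in> {1..m} \<Longrightarrow> j \<noteq> i \<Longrightarrow> eval_mpoly f (P j) = 0"
      using d by (rule indicator_form) blast
    have "unit_fun i = eval_at A f"
      using f(2,3) that A by (auto simp: unit_fun_def eval_at_def fun_eq_iff)
    then show ?thesis using f(1) by blast
  qed
  then have "vc.span (unit_fun ` A) \<subseteq> eval_at A ` hom_part d"
    by (intro vc.span_minimal sub) blast
  then show "coords A \<subseteq> eval_at A ` hom_part d" unfolding span_unit_fun[OF fin] .
qed

lemma hilbert_fun_eq_dim:
  assumes "\<And>f. f \<in> hom_part d \<Longrightarrow> f \<in> J \<longleftrightarrow> eval_at A f = 0"
  shows "hilbert_fun J d = vc.dim (eval_at A ` hom_part d)"
  unfolding hilbert_fun_def using assms
  by (intro quot_dim_kernel linear_eval_at subspace_hom_part) simp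

lemma hilbert_fun_large:
  assumes "\<And>f. f \<in> hom_part d \<Longrightarrow> f \<in> J \<longleftrightarrow> eval_at A f = 0" "A \<subseteq> {1..m}" "m \<le> d"
  shows "hilbert_fun J d = card A"
proof -
  have "finite A" using assms(2) by (rule finite_subset) simp
  then show ?thesis
    using hilbert_fun_eq_dim[OF assms(1)] eval_at_surj[OF assms(2,3)] by (simp add: dim_coords)
qed

text \<open>
  The degree of an ideal \<open>J\<close> that is squeezed between the vanishing ideal of all the points and that of a
  non-empty subset \<open>A\<close>, and which has the same forms as the latter in large degrees. The first two
  conditions force Krull dimension 1, so that the degree is the limit of the Hilbert function itself;
  the last one determines this limit. The freedom in small degrees allows \<open>J\<close> to be \<open>(I, F)\<close>.
\<close>

lemma quot_degree_eq_card:
  assumes J: "ideal J \<S>" and lower: "line_ideal (P ` {1..m}) \<subseteq> J"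
    and upper: "J \<subseteq> line_ideal (P ` A)" and A: "A \<subseteq> {1..m}" "A \<noteq> {}"
    and ev: "\<And>d f. d\<^sub>0 \<le> d \<Longrightarrow> f \<in> hom_part d \<Longrightarrow> eval_at A f = 0 \<Longrightarrow> f \<in> J"
  shows "quot_degree J = card A"
proof -
  obtain i where i: "i \<in> A" using A(2) by blast
  have "krull_dim (\<S> Quot J) \<le> 1"
  proof (rule krull_dim_quot_le_1[OF _ _ J lower])
    show "0 \<notin> P ` {1..m}" using nonzero by (metis imageE)
  qed simp
  moreover have "krull_dim (\<S> Quot J) \<ge> 1"
  proof (rule krull_dim_quot_ge_1[OF _ J])
    show "P i \<noteq> 0" using i A(1) nonzero by blast
    show "J \<subseteq> line_ideal {P i}" using upper i by (auto simp: line_ideal_def)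
  qed
  ultimately have krull: "krull_dim (\<S> Quot J) = 1" by (rule antisym)
  have "hilbert_fun J d = card A" if "max d\<^sub>0 m \<le> d" for d
  proof (rule hilbert_fun_large)
    fix f :: "('n, 'a) mpoly" assume f: "f \<in> hom_part d"
    show "f \<in> J \<longleftrightarrow> eval_at A f = 0"
      using ev[OF _ f] upper that hom_in_line_ideal_iff[OF f, of A] unfolding eval_at_eq_0_iff by auto
  qed (use A that in simp_all)
  then have "\<forall>\<^sub>F d in sequentially. real (hilbert_fun J d) / real d ^ 0 = real (card A)"
    unfolding eventually_sequentially by (intro exI[of _ "max d\<^sub>0 m"]) simp
  then have "(\<lambda>d. real (hilbert_fun J d) / real d ^ 0) \<longlonglongrightarrow> real (card A)"
    by (rule tendsto_eventually)
  then show ?thesis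
    unfolding quot_degree_def krull by (simp add: one_enat_def limI)
qed

lemma quot_degree_line_ideal:
  assumes "A \<subseteq> {1..m}" "A \<noteq> {}"
  shows "quot_degree (line_ideal (P ` A)) = card A"
proof (rule quot_degree_eq_card[OF ideal_line_ideal _ subset_refl assms])
  show "line_ideal (P ` {1..m}) \<subseteq> line_ideal (P ` A)" unfolding line_ideal_def using assms(1) by blast
  show "f \<in> line_ideal (P ` A)" if "0 \<le> d" "f \<in> hom_part d" "eval_at A f = 0" for d and f :: "('n, 'a) mpoly"
    using that by (simp add: hom_in_line_ideal_iff eval_at_eq_0_iff)
qed

end

section \<open>Colon ideals, extended ideals and subcodes\<close>

context point_family
begin

(* Keeps the index set in the form {1..m}, in which the lemmas about it are stated. *)
declare One_nat_def [simp del]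

definition nonvanishing :: "('n, 'a) mpoly set \<Rightarrow> nat set"
  where "nonvanishing F = {i \<in> {1..m}. \<exists>f\<in>F. eval_mpoly f (P i) \<noteq> 0}"

abbreviation I\<^sub>X :: "('n, 'a) mpoly set"
  where "I\<^sub>X \<equiv> line_ideal (P ` {1..m})"

lemma nonvanishing_subset: "nonvanishing F \<subseteq> {1..m}"
  by (auto simp: nonvanishing_def)

lemma finite_nonvanishing [simp]: "finite (nonvanishing F)"
  using nonvanishing_subset by (rule finite_subset) simp

lemma card_nonvanishing_le: "card (nonvanishing F) \<le> m"
  using card_mono[OF _ nonvanishing_subset[of F]] by simp

lemma card_nonvanishing_eq_iff: "card (nonvanishing F) = m \<longleftrightarrow> nonvanishing F = {1..m}"
  using card_subset_eq[OF _ nonvanishing_subset[of F]] by force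

lemma code_supp_eval: "code_supp (eval_at {1..m} ` F) = nonvanishing F"
  by (auto simp: code_supp_def nonvanishing_def eval_at_def)

text \<open>
  Restricted to the line of \<open>P i\<close>, the condition \<open>g * f \<in> I\<close> is the vanishing of a product in the domain
  \<open>K[t]\<close>. So \<open>g\<close> must vanish on the line of each point at which some \<open>f \<in> F\<close> does not.
\<close>

lemma colon_eq:
  assumes "F \<subseteq> hom_part d"
  shows "colon I\<^sub>X F = line_ideal (P ` nonvanishing F)"
proof -
  have zero: "line_eval (P i) f = 0 \<longleftrightarrow> eval_mpoly f (P i) = 0" if "f \<in> F" for f i
    using line_eval_hom[of f d] that assms by (simp add: subset_iff)
  have "(\<forall>f\<in>F. g * f \<in> I\<^sub>X) \<longleftrightarrow> (\<forall>i\<in>nonvanishing F. line_eval (P i) g = 0)" for g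
  proof -
    have "(\<forall>f\<in>F. g * f \<in> I\<^sub>X) \<longleftrightarrow> (\<forall>f\<in>F. \<forall>i\<in>{1..m}. line_eval (P i) g = 0 \<or> eval_mpoly f (P i) = 0)"
      using zero by (simp add: line_ideal_def line_eval_mult)
    then show ?thesis unfolding nonvanishing_def by blast
  qed
  then show ?thesis by (simp add: colon_def line_ideal_def)
qed

text \<open>
  An indicator form of a point outside \<open>A\<close> vanishes on \<open>A\<close>, but not on all the points.
\<close>

lemma line_ideal_eq_iff:
  assumes "A \<subseteq> {1..m}"
  shows "line_ideal (P ` A) = I\<^sub>X \<longleftrightarrow> A = {1..m}"
proof
  assume eq: "line_ideal (P ` A) = I\<^sub>X"
  have "i \<in> A" if i: "i \<in> {1..m}" for i
  proof (rule ccontr)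
    assume nA: "i \<notin> A"
    obtain f where f: "f \<in> hom_part m" "eval_mpoly f (P i) = 1"
      "\<And>j. j \<in> {1..m} \<Longrightarrow> j \<noteq> i \<Longrightarrow> eval_mpoly f (P j) = 0"
      using i order_refl by (rule indicator_form) blast
    have "f \<in> line_ideal (P ` A)"
      unfolding hom_in_line_ideal_iff[OF f(1)] using f(3) nA assms by blast
    then have "eval_mpoly f (P i) = 0" using i unfolding eq hom_in_line_ideal_iff[OF f(1)] by blast
    then show False using f(2) by simp
  qed
  then show "A = {1..m}" using assms by blast
qed simp

lemma admissible_eq:
  "\<F> I\<^sub>X d r = {F. F \<subseteq> hom_part d \<and> finite F \<and> card F = r \<and> indep_mod I\<^sub>X F \<and> nonvanishing F \<noteq> {1..m}}"
proof -
  have "colon I\<^sub>X F \<noteq> I\<^sub>X \<longleftrightarrow> nonvanishing F \<noteq> {1..m}" if "F \<subseteq> hom_part d" for F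
    by (simp only: colon_eq[OF that] line_ideal_eq_iff[OF nonvanishing_subset])
  then show ?thesis unfolding admissible_def by (intro Collect_cong) metis
qed

lemma indep_mod_iff:
  assumes "F \<subseteq> hom_part d"
  shows "indep_mod I\<^sub>X F \<longleftrightarrow> inj_on (eval_at {1..m}) F \<and> vc.independent (eval_at {1..m} ` F)"
  using assms
  by (intro indep_mod_kernel_iff[OF linear_eval_at subspace_hom_part])
    (simp_all only: hom_in_line_ideal_iff eval_at_eq_0_iff)

lemma nonvanishing_nonempty:
  assumes "F \<subseteq> hom_part d" "indep_mod I\<^sub>X F" "F \<noteq> {}"
  shows "nonvanishing F \<noteq> {}"
proof
  assume empty: "nonvanishing F = {}"
  obtain f where f: "f \<in> F" using assms(3) by blast
  have "eval_at {1..m} f = 0" using empty f by (auto simp: eval_at_eq_0_iff nonvanishing_def)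
  then have "0 \<in> eval_at {1..m} ` F" using f by (metis imageI)
  then show False using vc.dependent_zero assms(1,2) indep_mod_iff by blast
qed

text \<open>
  \<open>(I, F)\<close> has the same forms of degree \<open>e \<ge> d + m\<close> as the vanishing ideal of the common zeros of \<open>F\<close>. To
  see that such a form \<open>f\<close> lies in \<open>(I, F)\<close>, choose for each other point \<open>P i\<close> some \<open>g i \<in> F\<close> with
  \<open>g i (P i) \<noteq> 0\<close> and an indicator form \<open>h i\<close> of degree \<open>e - d\<close>. A suitable combination \<open>u\<close> of the products
  \<open>h i * g i\<close> takes the same values as \<open>f\<close> at all the points, so \<open>f - u \<in> I\<close> and \<open>u \<in> (F)\<close>.
\<close>

lemma quot_degree_extended_ideal:
  assumes F: "F \<subseteq> hom_part d" and ne: "nonvanishing F \<noteq> {1..m}"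
  shows "quot_degree (genideal \<S> (I\<^sub>X \<union> F)) = real m - real (card (nonvanishing F))"
proof -
  let ?J = "genideal \<S> (I\<^sub>X \<union> F)" and ?A = "{1..m} - nonvanishing F"
  note ring = ring_from_type_algebra
  have carr: "I\<^sub>X \<union> F \<subseteq> carrier \<S>" by (simp add: ring_of_type_simps)
  have J: "ideal ?J \<S>" by (rule ring.genideal_ideal[OF ring carr])
  have gen: "I\<^sub>X \<union> F \<subseteq> ?J" by (rule ring.genideal_self[OF ring carr])
  have "quot_degree ?J = card ?A"
  proof (rule quot_degree_eq_card[OF J])
    show "I\<^sub>X \<subseteq> ?J" using gen by blast
    show "?J \<subseteq> line_ideal (P ` ?A)"
    proof (rule ring.genideal_minimal[OF ring ideal_line_ideal], rule Un_least)
      show "I\<^sub>X \<subseteq> line_ideal (P ` ?A)" unfolding line_ideal_def by blast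
      show "F \<subseteq> line_ideal (P ` ?A)"
      proof
        fix f assume f: "f \<in> F"
        then have "f \<in> hom_part d" using F by blast
        then show "f \<in> line_ideal (P ` ?A)"
          using f by (simp add: hom_in_line_ideal_iff nonvanishing_def)
      qed
    qed
    show "?A \<subseteq> {1..m}" by blast
    show "?A \<noteq> {}" using ne nonvanishing_subset[of F] by blast
    fix e f assume e: "d + m \<le> e" and f: "f \<in> hom_part e" and f0: "eval_at ?A f = 0"
    have "\<exists>g h. g \<in> F \<and> eval_mpoly g (P i) \<noteq> 0 \<and> h \<in> hom_part (e - d) \<and> eval_mpoly h (P i) = 1 \<and>
        (\<forall>j\<in>{1..m}. j \<noteq> i \<longrightarrow> eval_mpoly h (P j) = 0)" if "i \<in> nonvanishing F" for i
    proof -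
      from that have i: "i \<in> {1..m}" and "\<exists>g\<in>F. eval_mpoly g (P i) \<noteq> 0"
        unfolding nonvanishing_def by blast+
      moreover have "m \<le> e - d" using e by simp
      with i obtain h where "h \<in> hom_part (e - d)" "eval_mpoly h (P i) = 1"
        "\<And>j. j \<in> {1..m} \<Longrightarrow> j \<noteq> i \<Longrightarrow> eval_mpoly h (P j) = 0"
        by (rule indicator_form) blast
      ultimately show ?thesis by metis
    qed
    then obtain g h where gh: "\<And>i. i \<in> nonvanishing F \<Longrightarrow> g i \<in> F \<and> eval_mpoly (g i) (P i) \<noteq> 0 \<and>
        h i \<in> hom_part (e - d) \<and> eval_mpoly (h i) (P i) = 1 \<and>
        (\<forall>j\<in>{1..m}. j \<noteq> i \<longrightarrow> eval_mpoly (h i) (P j) = 0)"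
      by metis
    define c where "c i = eval_mpoly f (P i) / eval_mpoly (g i) (P i)" for i
    define u where "u = (\<Sum>i\<in>nonvanishing F. mscale (c i) (h i) * g i)"
    have "mscale (c i) (h i) * g i \<in> ?J" if "i \<in> nonvanishing F" for i
      using gh[OF that] gen by (intro ideal_of_typeD(3)[OF J]) blast
    then have uJ: "u \<in> ?J" unfolding u_def by (rule ideal_of_type_sum[OF J])
    have "mscale (c i) (h i) * g i \<in> hom_part (e - d + d)" if "i \<in> nonvanishing F" for i
      using gh[OF that] F by (intro hom_part_mult mp.subspace_scale subspace_hom_part) blast+
    then have u: "u \<in> hom_part e" unfolding u_def using e by (intro mp.subspace_sum subspace_hom_part) simp
    have "eval_mpoly (f - u) (P j) = 0" if j: "j \<in> {1..m}" for j
    proof -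
      have "eval_mpoly u (P j) = (\<Sum>i\<in>nonvanishing F. if i = j then eval_mpoly f (P j) else 0)"
        unfolding u_def eval_mpoly_sum using gh j
        by (intro sum.cong) (auto simp: eval_mpoly_mult eval_mpoly_scale c_def)
      also have "\<dots> = eval_mpoly f (P j)"
        using f0 j by (auto simp: eval_at_eq_0_iff)
      finally show ?thesis by (simp add: eval_mpoly_minus)
    qed
    moreover have "f - u \<in> hom_part e" using f u by (rule mp.subspace_diff[OF subspace_hom_part])
    ultimately have "f - u \<in> I\<^sub>X" by (simp add: hom_in_line_ideal_iff)
    then have "f - u \<in> ?J" using gen by blast
    from ideal_of_typeD(2)[OF J this uJ] show "f \<in> ?J" by simp
  qed
  also have "card ?A = m - card (nonvanishing F)"
    using card_Diff_subset[OF _ nonvanishing_subset[of F]] by simp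
  finally show ?thesis using card_nonvanishing_le[of F] by simp
qed

text \<open>
  These sets are the elements of \<open>\<F> I d r\<close> without the condition \<open>colon I F \<noteq> I\<close>. Modulo \<open>I\<close>, they are the bases
  of the \<open>r\<close>-dimensional subspaces of \<open>S\<^sub>d/I\<^sub>d\<close>.
\<close>

definition frames :: "nat \<Rightarrow> nat \<Rightarrow> ('n, 'a) mpoly set set"
  where "frames d r = {F. F \<subseteq> hom_part d \<and> finite F \<and> card F = r \<and> indep_mod I\<^sub>X F}"

text \<open>
  A basis of an \<open>r\<close>-dimensional subcode lifts to a set of \<open>r\<close> forms that are independent modulo \<open>I\<close>, because \<open>I\<close>
  is the kernel of the evaluation on forms; conversely, such a set evaluates to a basis of a subcode.
  The hypothesis \<open>r \<ge> 1\<close> ensures that a basis with \<open>card B = r\<close> is finite.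
\<close>

lemma subcode_weights:
  assumes r: "r \<ge> 1"
  shows "{card (code_supp D) | D. vc.subspace D \<and> D \<subseteq> eval_code m P d \<and> vc.dim D = r} =
    (\<lambda>F. card (nonvanishing F)) ` frames d r" (is "?L = ?R")
proof
  let ?E = "eval_at {1..m}"
  have C: "vc.subspace (?E ` hom_part d)"
    by (rule ev.linear_subspace_image[OF linear_eval_at subspace_hom_part])
  show "?L \<subseteq> ?R"
  proof
    fix w assume "w \<in> ?L"
    then obtain D where D: "w = card (code_supp D)" "vc.subspace D" "D \<subseteq> ?E ` hom_part d" "vc.dim D = r"
      unfolding eval_code_eq by blast
    obtain B where B: "B \<subseteq> D" "vc.independent B" "D \<subseteq> vc.span B" "card B = vc.dim D"
      by (rule vc.basis_exists)
    obtain F where F: "F \<subseteq> hom_part d" "inj_on ?E F" "B = ?E ` F"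
      using subset_trans[OF B(1) D(3)] unfolding subset_image_inj by blast
    have "card F = r" using B(4) D(4) by (simp add: F(3) card_image[OF F(2)])
    moreover from this have "finite F" using r by (metis card.infinite not_one_le_zero)
    ultimately have "F \<in> frames d r"
      using F B(2) by (simp add: frames_def indep_mod_iff)
    moreover have "D = vc.span (?E ` F)"
      using B(1,3) vc.span_minimal[OF B(1) D(2)] unfolding F(3) by blast
    then have "w = card (nonvanishing F)"
      by (simp add: D(1) code_supp_span code_supp_eval)
    ultimately show "w \<in> ?R" by blast
  qed
  show "?R \<subseteq> ?L"
  proof
    fix w assume "w \<in> ?R"
    then obtain F where F: "F \<in> frames d r" "w = card (nonvanishing F)" by blast
    then have hom: "F \<subseteq> hom_part d" and "indep_mod I\<^sub>X F" by (simp_all add: frames_def)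
    then have ind: "inj_on ?E F" "vc.independent (?E ` F)" using indep_mod_iff[OF hom] by simp_all
    let ?D = "vc.span (?E ` F)"
    have "vc.dim ?D = r"
      using vc.dim_span_eq_card_independent[OF ind(2)] F(1) by (simp add: card_image[OF ind(1)] frames_def)
    moreover have "?D \<subseteq> ?E ` hom_part d" using hom by (intro vc.span_minimal C) blast
    moreover have "w = card (code_supp ?D)" by (simp add: F(2) code_supp_span code_supp_eval)
    moreover have "vc.subspace ?D" by (rule vc.subspace_span)
    ultimately show "w \<in> ?L" unfolding eval_code_eq by blast
  qed
qed

lemma frames_nonempty:
  assumes "r \<le> hilbert_fun I\<^sub>X d"
  shows "frames d r \<noteq> {}"
proof -
  let ?E = "eval_at {1..m}"
  have H: "hilbert_fun I\<^sub>X d = vc.dim (?E ` hom_part d)"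
    by (rule hilbert_fun_eq_dim) (simp only: hom_in_line_ideal_iff eval_at_eq_0_iff)
  obtain B where B: "B \<subseteq> ?E ` hom_part d" "vc.independent B" "card B = hilbert_fun I\<^sub>X d"
    unfolding H by (rule vc.basis_exists)
  have "finite B"
  proof -
    have "B \<subseteq> vc.span (unit_fun ` {1..m})"
      unfolding span_unit_fun[OF finite_atLeastAtMost] using B(1) eval_at_in_coords by blast
    then have "finite B \<and> card B \<le> card (unit_fun ` {1..m} :: (nat \<Rightarrow> 'a) set)"
      by (intro vc.independent_span_bound B(2)) simp_all
    then show ?thesis ..
  qed
  then obtain B' where B': "B' \<subseteq> B" "card B' = r" "finite B'"
    using obtain_subset_with_card_n[of r B] assms B(3) by metis
  obtain F where F: "F \<subseteq> hom_part d" "inj_on ?E F" "B' = ?E ` F"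
    using subset_trans[OF B'(1) B(1)] unfolding subset_image_inj by blast
  have "finite F" using B'(3) F(2,3) finite_imageD by blast
  moreover have "card F = r" using B'(2) by (simp add: F(3) card_image[OF F(2)])
  moreover have "indep_mod I\<^sub>X F"
    unfolding indep_mod_iff[OF F(1)] using F(2,3) B(2) B'(1) vc.independent_mono by blast
  ultimately show ?thesis using F(1) by (auto simp: frames_def)
qed

end

section \<open>The three invariants\<close>

context point_family
begin

text \<open>
  Let \<open>w\<close> be the least value of \<open>card (nonvanishing F)\<close>, the weight of \<open>F\<close>, over all frames \<open>F\<close>. The admissible sets are the frames of weight other than
  \<open>m\<close>. If there are any, then \<open>w < m\<close> and a frame of weight \<open>w\<close> is itself admissible, so restricting the
  minimum to admissible sets does not change it.
\<close>

lemma weight_eq_gmd_eq_vasconcelos: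
  assumes r: "1 \<le> r" "r \<le> hilbert_fun I\<^sub>X d" and m: "1 \<le> m"
  shows "real (gen_hamming_weight (eval_code m P d) r) = gmd I\<^sub>X d r"
    and "gmd I\<^sub>X d r = vasconcelos I\<^sub>X d r"
proof -
  define wt where "wt F = card (nonvanishing F)" for F
  define w where "w = gen_hamming_weight (eval_code m P d) r"
  have w: "w = Min (wt ` frames d r)"
    unfolding w_def gen_hamming_weight_def subcode_weights[OF r(1)] wt_def ..
  have le_m: "wt F \<le> m" for F unfolding wt_def by (rule card_nonvanishing_le)
  have fin: "finite (wt ` \<G>)" for \<G>
    using le_m by (intro finite_subset[OF _ finite_atMost[of m]]) blast
  have ne: "wt ` frames d r \<noteq> {}" using frames_nonempty[OF r(2)] by simp
  have w_le: "w \<le> wt F" if "F \<in> frames d r" for F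
    unfolding w using fin that by (intro Min_le) simp_all
  have "w \<in> wt ` frames d r" unfolding w by (rule Min_in[OF fin ne])
  then obtain F\<^sub>0 where F0: "F\<^sub>0 \<in> frames d r" "wt F\<^sub>0 = w" by blast
  have adm: "\<F> I\<^sub>X d r = {F \<in> frames d r. wt F \<noteq> m}"
    unfolding admissible_eq frames_def wt_def card_nonvanishing_eq_iff by blast
  have degI: "quot_degree I\<^sub>X = real m"
    using quot_degree_line_ideal[of "{1..m}"] m by simp
  have vas: "quot_degree (colon I\<^sub>X F) = real (wt F)" if "F \<in> frames d r" for F
  proof -
    have F: "F \<subseteq> hom_part d" "indep_mod I\<^sub>X F" "F \<noteq> {}" using that r(1) by (auto simp: frames_def)
    show ?thesis
      unfolding wt_def colon_eq[OF F(1)]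
      by (rule quot_degree_line_ideal[OF nonvanishing_subset nonvanishing_nonempty[OF F]])
  qed
  have ext: "quot_degree (genideal \<S> (I\<^sub>X \<union> F)) = real m - real (wt F)" if "F \<in> \<F> I\<^sub>X d r" for F
  proof -
    have "F \<subseteq> hom_part d" "nonvanishing F \<noteq> {1..m}" using that unfolding admissible_eq by simp_all
    then show ?thesis unfolding wt_def by (rule quot_degree_extended_ideal)
  qed
  have "gmd I\<^sub>X d r = real w \<and> vasconcelos I\<^sub>X d r = real w"
  proof (cases "\<F> I\<^sub>X d r = {}")
    case True
    then have "w = m" using F0 unfolding adm by blast
    then show ?thesis by (simp add: gmd_def vasconcelos_def True degI)
  next
    case False
    then obtain F where "F \<in> frames d r" "wt F \<noteq> m" unfolding adm by blast
    then have "w \<noteq> m" using w_le[of F] le_m[of F] by simp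
    then have F0_adm: "F\<^sub>0 \<in> \<F> I\<^sub>X d r" using F0 unfolding adm by simp
    have frame: "F \<in> frames d r" if "F \<in> \<F> I\<^sub>X d r" for F using that unfolding adm by blast
    have "Max ((\<lambda>F. quot_degree (genideal \<S> (I\<^sub>X \<union> F))) ` \<F> I\<^sub>X d r) =
        Max ((\<lambda>k. real m - real k) ` wt ` \<F> I\<^sub>X d r)"
      by (simp add: ext image_image cong: image_cong)
    also have "\<dots> = real m - real w"
    proof (rule Max_eqI)
      show "finite ((\<lambda>k. real m - real k) ` wt ` \<F> I\<^sub>X d r)" using fin by (rule finite_imageI)
      show "y \<le> real m - real w" if "y \<in> (\<lambda>k. real m - real k) ` wt ` \<F> I\<^sub>X d r" for y
        using that w_le[OF frame] by auto
      show "real m - real w \<in> (\<lambda>k. real m - real k) ` wt ` \<F> I\<^sub>X d r"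
        using F0_adm F0(2) by blast
    qed
    finally have gmd: "gmd I\<^sub>X d r = real w" using False by (simp add: gmd_def degI)
    have "Min ((\<lambda>F. quot_degree (colon I\<^sub>X F)) ` \<F> I\<^sub>X d r) = Min (real ` wt ` \<F> I\<^sub>X d r)"
      by (simp add: vas frame image_image cong: image_cong)
    also have "\<dots> = real w"
    proof (rule Min_eqI)
      show "finite (real ` wt ` \<F> I\<^sub>X d r)" using fin by (rule finite_imageI)
      show "real w \<le> y" if "y \<in> real ` wt ` \<F> I\<^sub>X d r" for y
        using that w_le[OF frame] by auto
      show "real w \<in> real ` wt ` \<F> I\<^sub>X d r" using F0_adm F0(2) by blast
    qed
    finally have "vasconcelos I\<^sub>X d r = real w" using False by (simp add: vasconcelos_def)
    with gmd show ?thesis ..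
  qed
  then show "real (gen_hamming_weight (eval_code m P d) r) = gmd I\<^sub>X d r"
    and "gmd I\<^sub>X d r = vasconcelos I\<^sub>X d r"
    by (simp_all add: w_def)
qed

text \<open>
  The Hilbert function is eventually equal to \<open>m\<close>, and a polynomial with infinitely many equal values
  is constant. So the Hilbert polynomial is \<open>m\<close>.
\<close>

lemma hilbert_fun_beyond_reg:
  assumes "reg I\<^sub>X \<le> d"
  shows "hilbert_fun I\<^sub>X d = m"
proof -
  have large: "hilbert_fun I\<^sub>X e = m" if "m \<le> e" for e
  proof -
    have "hilbert_fun I\<^sub>X e = card {1..m}"
      by (rule hilbert_fun_large) (simp_all only: hom_in_line_ideal_iff eval_at_eq_0_iff that subset_refl)
    then show ?thesis by simp
  qed
  have "h = [:of_nat m:]"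
    if "\<forall>\<^sub>F e in sequentially. of_nat (hilbert_fun I\<^sub>X e) = poly h (of_nat e)" for h :: "rat poly"
  proof -
    obtain N where N: "\<And>e. N \<le> e \<Longrightarrow> of_nat (hilbert_fun I\<^sub>X e) = poly h (of_nat e)"
      using \<open>\<forall>\<^sub>F e in sequentially. _\<close> unfolding eventually_sequentially by blast
    have "of_nat ` {max N m..} \<subseteq> {x. poly (h - [:of_nat m:]) x = 0}"
    proof
      fix x :: rat assume "x \<in> of_nat ` {max N m..}"
      then obtain e where e: "x = of_nat e" "N \<le> e" "m \<le> e" by auto
      show "x \<in> {x. poly (h - [:of_nat m:]) x = 0}"
        using N[OF e(2)] large[OF e(3)] by (simp add: e(1))
    qed
    moreover have "infinite (of_nat ` {max N m..} :: rat set)"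
      by (simp add: finite_image_iff infinite_Ici)
    ultimately have "infinite {x. poly (h - [:of_nat m:]) x = 0}" using finite_subset by blast
    then have "h - [:of_nat m:] = 0" using poly_roots_finite by blast
    then show ?thesis by simp
  qed
  moreover have "\<forall>\<^sub>F e in sequentially. of_nat (hilbert_fun I\<^sub>X e) = poly [:of_nat m :: rat:] (of_nat e)"
    unfolding eventually_sequentially using large by (intro exI[of _ m]) simp
  ultimately have H: "hilbert_poly I\<^sub>X = [:of_nat m:]"
    unfolding hilbert_poly_def by (intro the_equality)
  have "\<forall>e\<ge>reg I\<^sub>X. of_nat (hilbert_fun I\<^sub>X e) = poly (hilbert_poly I\<^sub>X) (of_nat e)"
    unfolding reg_def by (rule LeastI[of _ m]) (simp add: H large)
  then have "(of_nat (hilbert_fun I\<^sub>X d) :: rat) = of_nat m" using assms by (simp add: H)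
  then show ?thesis by simp
qed

text \<open>
  The code is all of \<open>K\<^sup>m\<close>. A subcode has dimension at most the size of its support, and the
  coordinate subspace of the first \<open>r\<close> positions attains this bound.
\<close>

lemma weight_eq_rank:
  assumes full: "hilbert_fun I\<^sub>X d = m" and r: "r \<le> m"
  shows "gen_hamming_weight (eval_code m P d) r = r"
proof -
  let ?C = "eval_code m P d"
  have "?C = coords {1..m}"
  proof (rule full_dim_coords)
    show "vc.subspace ?C"
      unfolding eval_code_eq by (rule ev.linear_subspace_image[OF linear_eval_at subspace_hom_part])
    show "?C \<subseteq> coords {1..m}" unfolding eval_code_eq using eval_at_in_coords by blast
    have "hilbert_fun I\<^sub>X d = vc.dim (eval_at {1..m} ` hom_part d)"
      by (rule hilbert_fun_eq_dim) (simp only: hom_in_line_ideal_iff eval_at_eq_0_iff)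
    then show "vc.dim ?C = card {1..m}" by (simp add: eval_code_eq full)
  qed simp
  note C = this
  have fin: "finite (code_supp D)" "card (code_supp D) \<le> m" if "D \<subseteq> ?C" for D
  proof -
    have sub: "code_supp D \<subseteq> {1..m}" using that unfolding C coords_def code_supp_def by blast
    then show "finite (code_supp D)" by (rule finite_subset) simp
    show "card (code_supp D) \<le> m" using card_mono[OF _ sub] by simp
  qed
  show ?thesis
    unfolding gen_hamming_weight_def
  proof (rule Min_eqI)
    let ?W = "{card (code_supp D) |D. vc.subspace D \<and> D \<subseteq> ?C \<and> vc.dim D = r}"
    show "finite ?W" using fin(2) by (intro finite_subset[OF _ finite_atMost[of m]]) blast
    show "r \<le> w" if "w \<in> ?W" for w using that dim_le_card_code_supp[OF fin(1)] by blast
    have "code_supp (coords {1..r} :: (nat \<Rightarrow> 'a) set) = {1..r}"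
    proof
      show "code_supp (coords {1..r} :: (nat \<Rightarrow> 'a) set) \<subseteq> {1..r}" unfolding coords_def code_supp_def by blast
      have "unit_fun i \<in> (coords {1..r} :: (nat \<Rightarrow> 'a) set)" "(unit_fun i :: nat \<Rightarrow> 'a) i \<noteq> 0"
        if "i \<in> {1..r}" for i
        using that by (simp_all add: unit_fun_def coords_def)
      then show "{1..r} \<subseteq> code_supp (coords {1..r} :: (nat \<Rightarrow> 'a) set)" unfolding code_supp_def by blast
    qed
    moreover have "(coords {1..r} :: (nat \<Rightarrow> 'a) set) \<subseteq> ?C" unfolding C coords_def using r by auto
    moreover have "vc.dim (coords {1..r} :: (nat \<Rightarrow> 'a) set) = r" by (simp add: dim_coords)
    ultimately show "r \<in> ?W" using subspace_coords by (intro CollectI exI[of _ "coords {1..r}"]) simp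
  qed
qed

text \<open>
  A polynomial whose restriction to the line of \<open>P i\<close> is zero has homogeneous components that vanish on
  this whole line. So it is a sum of generators of the vanishing ideal.
\<close>

lemma vanishing_ideal_eq: "vanishing_ideal ((\<lambda>i. proj_pt (P i)) ` {1..m}) = I\<^sub>X"
proof
  let ?G = "{f :: ('n, 'a) mpoly. (\<exists>d. f \<in> hom_part d) \<and>
    (\<forall>p\<in>(\<lambda>i. proj_pt (P i)) ` {1..m}. \<forall>v\<in>p. eval_mpoly f v = 0)}"
  note ring = ring_from_type_algebra
  have carr: "?G \<subseteq> carrier \<S>" by (simp only: ring_of_type_simps subset_UNIV)
  note J = ring.genideal_ideal[OF ring carr]
  show "vanishing_ideal ((\<lambda>i. proj_pt (P i)) ` {1..m}) \<subseteq> I\<^sub>X"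
    unfolding vanishing_ideal_def
  proof (rule ring.genideal_minimal[OF ring ideal_line_ideal], rule subsetI)
    fix f assume "f \<in> ?G"
    then obtain d where d: "f \<in> hom_part d"
      and v: "\<And>i v. i \<in> {1..m} \<Longrightarrow> v \<in> proj_pt (P i) \<Longrightarrow> eval_mpoly f v = 0"
      by blast
    have "P i \<in> proj_pt (P i)" for i unfolding proj_pt_def by (intro CollectI exI[of _ 1]) simp
    then show "f \<in> I\<^sub>X" unfolding hom_in_line_ideal_iff[OF d] using v by blast
  qed
  show "I\<^sub>X \<subseteq> vanishing_ideal ((\<lambda>i. proj_pt (P i)) ` {1..m})"
    unfolding vanishing_ideal_def
  proof
    fix f assume f: "f \<in> I\<^sub>X"
    have "hom_comp d f \<in> ?G" for d
    proof -
      have "eval_mpoly (hom_comp d f) (c *s P i) = 0" if "i \<in> {1..m}" for i c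
      proof -
        have "line_eval (P i) f = 0" using f that by (simp add: line_ideal_def)
        then have "eval_mpoly (hom_comp d f) (P i) = 0" by (simp add: line_eval_eq_0_iff)
        then show ?thesis
          by (simp add: eval_mpoly_scaled_point line_eval_hom[OF hom_comp_in_hom_part])
      qed
      then have "\<forall>p\<in>(\<lambda>i. proj_pt (P i)) ` {1..m}. \<forall>v\<in>p. eval_mpoly (hom_comp d f) v = 0"
        unfolding proj_pt_def by blast
      then show ?thesis using hom_comp_in_hom_part[of d f] by (intro CollectI conjI exI[of _ d])
    qed
    then have "hom_comp d f \<in> genideal \<S> ?G" for d
      by (rule subsetD[OF ring.genideal_self[OF ring carr]])
    then have "(\<Sum>d\<in>mdeg ` Poly_Mapping.keys f. hom_comp d f) \<in> genideal \<S> ?G"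
      by (rule ideal_of_type_sum[OF J])
    then show "f \<in> genideal \<S> ?G" unfolding sum_hom_comp[symmetric] .
  qed
qed

end

theorem theorem4p5:
  fixes \<X> :: "('a::field ^ 'n::{finite,linorder}) set set"
    and m :: nat
    and P :: "nat \<Rightarrow> 'a ^ 'n::{finite,linorder}"
  assumes "finite \<X>" and "\<X> \<subseteq> proj_space" and "card \<X> \<ge> 2"
    and "m = card \<X>"
    and "\<forall>i\<in>{1..m}. normalized_rep (P i)"
    and "\<X> = (\<lambda>i. proj_pt (P i)) ` {1..m}"
  shows
    "(\<forall>d r. 1 \<le> d \<and> 1 \<le> r \<and> r \<le> hilbert_fun (vanishing_ideal \<X>) d \<longrightarrow>
        real (gen_hamming_weight (eval_code m P d) r) = gmd (vanishing_ideal \<X>) d r \<and>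
        gmd (vanishing_ideal \<X>) d r = vasconcelos (vanishing_ideal \<X>) d r) \<and>
     (\<forall>d r. reg (vanishing_ideal \<X>) \<le> d \<and> 1 \<le> r \<and> r \<le> hilbert_fun (vanishing_ideal \<X>) d \<longrightarrow>
        gen_hamming_weight (eval_code m P d) r = r)"
proof -
  \<comment> \<open>Indices of proportional representatives agree, because \<open>i \<mapsto> [P\<^sub>i]\<close> maps onto \<open>\<X>\<close> and \<open>card \<X> = m\<close>.\<close>
  interpret point_family P m
  proof
    show nz: "P i \<noteq> 0" if "i \<in> {1..m}" for i
    proof
      assume zero: "P i = 0"
      have "normalized_rep (P i)" using assms(5) that by (rule bspec)
      then show False unfolding normalized_rep_def zero by simp
    qed
    fix i j c assume ij: "i \<in> {1..m}" "j \<in> {1..m}" and eq: "P i = c *s P j"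
    have "c \<noteq> 0" using nz[OF ij(1)] unfolding eq by (metis vector_smult_lzero)
    have same: "proj_pt (P i) = proj_pt (P j)"
    proof
      show "proj_pt (P i) \<subseteq> proj_pt (P j)"
      proof
        fix v assume "v \<in> proj_pt (P i)"
        then obtain b where "b \<noteq> 0" "v = b *s P i" unfolding proj_pt_def by blast
        then have "v = (b * c) *s P j" "b * c \<noteq> 0" using \<open>c \<noteq> 0\<close> by (simp_all add: eq)
        then show "v \<in> proj_pt (P j)" unfolding proj_pt_def by blast
      qed
      show "proj_pt (P j) \<subseteq> proj_pt (P i)"
      proof
        fix v assume "v \<in> proj_pt (P j)"
        then obtain b where "b \<noteq> 0" "v = b *s P j" unfolding proj_pt_def by blast
        then have "v = (b / c) *s P i" "b / c \<noteq> 0" using \<open>c \<noteq> 0\<close> by (simp_all add: eq)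
        then show "v \<in> proj_pt (P i)" unfolding proj_pt_def by blast
      qed
    qed
    have inj: "inj_on (\<lambda>i. proj_pt (P i)) {1..m}"
    proof (rule eq_card_imp_inj_on)
      show "card ((\<lambda>i. proj_pt (P i)) ` {1..m}) = card {1..m}"
        unfolding assms(6)[symmetric] using assms(4) by simp
    qed simp
    show "i = j" by (rule inj_onD[OF inj same ij])
  qed
  have I: "vanishing_ideal \<X> = I\<^sub>X" unfolding assms(6) by (rule vanishing_ideal_eq)
  have m: "1 \<le> m" using assms(3,4) by simp
  show ?thesis
    unfolding I
  proof (intro conjI allI impI; elim conjE)
    fix d r assume r: "1 \<le> r" "r \<le> hilbert_fun I\<^sub>X d"
    show "real (gen_hamming_weight (eval_code m P d) r) = gmd I\<^sub>X d r"
      and "gmd I\<^sub>X d r = vasconcelos I\<^sub>X d r"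
      using r m by (rule weight_eq_gmd_eq_vasconcelos)+
    assume "reg I\<^sub>X \<le> d"
    then have "hilbert_fun I\<^sub>X d = m" by (rule hilbert_fun_beyond_reg)
    then show "gen_hamming_weight (eval_code m P d) r = r"
      using r(2) by (simp add: weight_eq_rank)
  qed
qed

end
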